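(* Let $n\geq 2$, let $A\in\mathbb{Z}^{m\times n}$ be an integral matrix of full column rank, and let $b\in\mathbb{Z}^m$ be such that the polyhedron $P=\{x\in\mathbb{R}^n: Ax\le b\}$ is full-dimensional, contains no integer point ($P\cap\mathbb{Z}^n=\emptyset$), and each row of $A$ defines a facet of $P$. Then there exists a row $a^\top$ of $A$ such that \[ w^{a}(P)<\frac{4n+2}{9}\cdot\Delta_n(A)-1. \]
   Context: $\Delta_n(A)$ denotes the maximum of $|\det M|$ over all $n\times n$ submatrices $M$ of $A$. For $a\in\mathbb{R}^n\setminus\{0\}$, the width of $P$ in direction $a$ is $w^{a}(P)=\max_{x\in P}a^\top x-\min_{y\in P}a^\top y$. *)

theory Defs
  imports "HOL-Analysis.Analysis" "HOL-Library.Extended_Real"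
begin

text \<open>Delta_n(A): maximum absolute value of the determinant of an n x n submatrix of A
  (n = number of columns). An n x n submatrix is obtained by choosing n distinct rows,
  given here by an injective map from the column index type to the row index type
  (the row order only affects the sign of the determinant).\<close>
definition Delta :: "real^'n^'m \<Rightarrow> real" where
  "Delta A = Max {\<bar>det ((\<chi> i. A $ f i) :: real^'n^'n)\<bar> | f :: 'n \<Rightarrow> 'm. inj f}"

definition width :: "real^'n \<Rightarrow> (real^'n) set \<Rightarrow> ereal" where
  "width a P = (SUP x\<in>P. ereal (a \<bullet> x)) - (INF y\<in>P. ereal (a \<bullet> y))"

definition polyh :: "real^'n^'m \<Rightarrow> real^'m \<Rightarrow> (real^'n) set" where
  "polyh A b = {x. \<forall>i. (A *v x) $ i \<le> b $ i}"

end

theory Submission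
  imports Defs
begin

text \<open>
  Pass to a minimal set I of rows whose inequalities have no common integer solution and fix a row a_i in I. Among
  the integer points satisfying the other inequalities of I let z minimise a_i z, so a_i z \<ge> b_i + 1.
  For x in P, change the signs of the rows so that all of them are nonnegative on d = x - z. By minimality and
  integrality of b, no integer u with a_i u > 0 satisfies -1 < a_j u < a_j d + 1 for all j, and the same
  holds for every point y of the spindle 0 \<le> a_j y \<le> a_j d in place of d.

  The bound a_i d < (4n + 2)/9 \<Delta> follows from two facts. First, walking along edges of the spindle from 0 to d
  one meets a vertex y such that y and d - y lie on faces of dimensions k and n - k of the cone of all points
  where the rows are nonnegative; so d is a sum of spindle points on 2- and 3-dimensional faces. Second, if y
  lies on a face of dimension 2 or 3, then a_i y < \<Delta> or a_i y < 4/3 \<Delta>, respectively. Otherwise Minkowski's theorem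
  gives a nonzero integer u with u = \<theta> y + t, where a_i t = 0, all \<bar>a_j t\<bar> < 1, and \<theta> \<in> [0, 1] without loss of
  generality, and u contradicts the choice of z. In dimension 3 this needs that a symmetric convex polygon
  bounded by lines \<pi> s = 1 with all determinants of pairs of \<pi> at most 1 has area at least 3.
\<close>

section \<open>Vertices of polyhedra\<close>

text \<open>On a k-dimensional face the lattice-point argument compares a minor with the height a_i
  y times the volume of a (k - 1)-dimensional section, given by |a_j t| < 1/2 for all j. In
  coordinates taken from rows of a largest minor this volume is at least 1 for k = 2 and at least
  3/4 for k = 3; hence the factors 1 and 4/3. Three dimensions for 4/3 are cheaper than two for 1,
  which gives the slope 4/9. The final -1 is the distance from b_i, an upper bound of a_i on P, to
  a_i z \<ge> b_i + 1. Strictness needs care at two places. A lattice point is only guaranteed by a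
  volume strictly above the determinant; since a_i u is an integer, the body may be given height
  floor(a_i y) + 1 instead of a_i y. The infimum in the width must not lose the strict bound; it is
  attained at a vertex of P.\<close>

definition halfspaces_Int :: "('a::euclidean_space \<times> real) set \<Rightarrow> 'a set" where
  "halfspaces_Int H = {x. \<forall>(g, \<beta>)\<in>H. g \<bullet> x \<le> \<beta>}"

definition tight :: "('a::euclidean_space \<times> real) set \<Rightarrow> 'a \<Rightarrow> ('a \<times> real) set" where
  "tight H x = {(g, \<beta>)\<in>H. g \<bullet> x = \<beta>}"

definition is_vertex :: "('a::euclidean_space \<times> real) set \<Rightarrow> 'a \<Rightarrow> bool" where
  "is_vertex H x \<longleftrightarrow> x \<in> halfspaces_Int H \<and> span (fst ` tight H x) = UNIV"

lemma eq_zero_if_orthogonal_to_spanning: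
  fixes x :: "'a::euclidean_space"
  assumes "span S = UNIV" and "\<And>g. g \<in> S \<Longrightarrow> g \<bullet> x = 0"
  shows "x = 0"
proof -
  have "orthogonal x x"
    by (rule orthogonal_to_span[of _ S]) (use assms in \<open>auto simp: orthogonal_def inner_commute\<close>)
  then show ?thesis by (simp add: orthogonal_def)
qed

text \<open>A vertex is the only solution of its tight equations, so the subset
  \<open>tight H x\<close> of \<open>H\<close> determines it.\<close>

lemma finite_vertices:
  assumes "finite H"
  shows "finite {x. is_vertex H x}"
proof (rule finite_imageD)
  show "finite (tight H ` {x. is_vertex H x})"
    by (rule finite_subset[of _ "Pow H"]) (use assms in \<open>auto simp: tight_def\<close>)
  show "inj_on (tight H) {x. is_vertex H x}"
  proof (rule inj_onI)
    fix x y assume xy: "x \<in> {x. is_vertex H x}" "y \<in> {x. is_vertex H x}" "tight H x = tight H y"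
    have "x - y = 0"
    proof (rule eq_zero_if_orthogonal_to_spanning[of "fst ` tight H x"])
      show "span (fst ` tight H x) = UNIV" using xy by (auto simp: is_vertex_def)
      fix g assume "g \<in> fst ` tight H x"
      then obtain \<beta> where "(g, \<beta>) \<in> tight H x" by force
      moreover from this xy(3) have "(g, \<beta>) \<in> tight H y" by simp
      ultimately show "g \<bullet> (x - y) = 0" by (auto simp: tight_def inner_diff_right)
    qed
    then show "x = y" by simp
  qed
qed

text \<open>The ratio test of the simplex method: \<open>t\<close> is the step at which the first
  constraint increasing along \<open>h\<close> becomes tight. Constraints already tight stay so
  because \<open>h\<close> is orthogonal to them.\<close>

lemma more_tight_along_direction:
  assumes fin: "finite H" and x: "x \<in> halfspaces_Int H"
    and h0: "\<And>g \<beta>. (g, \<beta>) \<in> tight H x \<Longrightarrow> g \<bullet> h = 0"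
    and up: "\<exists>(g, \<beta>)\<in>H. g \<bullet> h > 0"
  obtains t where "t > 0" "x + t *\<^sub>R h \<in> halfspaces_Int H" "tight H x \<subset> tight H (x + t *\<^sub>R h)"
proof -
  define R where "R = (\<lambda>(g, \<beta>). (\<beta> - g \<bullet> x) / (g \<bullet> h)) ` {(g, \<beta>)\<in>H. g \<bullet> h > 0}"
  define t where "t = Min R"
  have R: "finite R" "R \<noteq> {}" using fin up by (auto simp: R_def intro: finite_subset[OF _ fin])
  then have "t \<in> R" unfolding t_def by (rule Min_in)
  then obtain g \<beta> where g: "(g, \<beta>) \<in> H" "g \<bullet> h > 0" "t = (\<beta> - g \<bullet> x) / (g \<bullet> h)"
    by (auto simp: R_def)
  have slack: "\<beta> - g \<bullet> x > 0" if "(g, \<beta>) \<in> H" "g \<bullet> h > 0" for g \<beta>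
    using that x h0[of g \<beta>] by (force simp: halfspaces_Int_def tight_def)
  have t: "t > 0" using slack[OF g(1,2)] g by simp
  have "x + t *\<^sub>R h \<in> halfspaces_Int H"
    unfolding halfspaces_Int_def
  proof clarsimp
    fix g' \<beta>' assume g': "(g', \<beta>') \<in> H"
    then have le: "g' \<bullet> x \<le> \<beta>'" using x by (auto simp: halfspaces_Int_def)
    show "g' \<bullet> (x + t *\<^sub>R h) \<le> \<beta>'"
    proof (cases "g' \<bullet> h > 0")
      case True
      then have "t \<le> (\<beta>' - g' \<bullet> x) / (g' \<bullet> h)"
        unfolding t_def by (intro Min_le R) (use g' in \<open>auto simp: R_def\<close>)
      with True show ?thesis by (simp add: inner_add_right field_simps)
    next
      case False
      then have "t * (g' \<bullet> h) \<le> 0" using t by (simp add: mult_nonneg_nonpos)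
      with le show ?thesis by (simp add: inner_add_right)
    qed
  qed
  moreover have "tight H x \<subseteq> tight H (x + t *\<^sub>R h)"
    using h0 by (auto simp: tight_def inner_add_right)
  moreover have "(g, \<beta>) \<in> tight H (x + t *\<^sub>R h)" "(g, \<beta>) \<notin> tight H x"
    using g h0[of g \<beta>] by (auto simp: tight_def inner_add_right)
  ultimately show ?thesis using t that by blast
qed

text \<open>Take a feasible point not above \<open>x\<close> with as many tight constraints as
  possible. If its tight normals did not span, a direction orthogonal to all of them would lead to a
  point with more.\<close>

lemma exists_vertex_below:
  fixes H :: "('a::euclidean_space \<times> real) set"
  assumes fin: "finite H" and sp: "span (fst ` H) = UNIV"
    and x: "x \<in> halfspaces_Int H" and bdd: "\<And>y. y \<in> halfspaces_Int H \<Longrightarrow> m \<le> l \<bullet> y"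
  obtains v where "is_vertex H v" "l \<bullet> v \<le> l \<bullet> x"
proof -
  define Q where "Q y \<longleftrightarrow> y \<in> halfspaces_Int H \<and> l \<bullet> y \<le> l \<bullet> x" for y
  have "Q x" using x by (simp add: Q_def)
  moreover have "\<forall>y. Q y \<longrightarrow> card (tight H y) < Suc (card H)"
    using fin by (auto simp: tight_def less_Suc_eq_le intro!: card_mono)
  ultimately obtain v where v: "Q v" and mx: "\<And>y. Q y \<Longrightarrow> card (tight H y) \<le> card (tight H v)"
    using ex_has_greatest_nat[of Q x "\<lambda>y. card (tight H y)"] by blast
  have "span (fst ` tight H v) = UNIV"
  proof (rule ccontr)
    assume "span (fst ` tight H v) \<noteq> UNIV"
    then obtain a where a: "a \<noteq> 0" "\<forall>w\<in>span (fst ` tight H v). a \<bullet> w = 0"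
      using span_not_UNIV_orthogonal by metis
    have tz: "g \<bullet> a = 0" if "(g, \<beta>) \<in> tight H v" for g \<beta>
    proof -
      have "g \<in> span (fst ` tight H v)" using that by (intro span_base) force
      then show ?thesis using a(2) by (metis inner_commute)
    qed
    \<comment> \<open>If \<open>l\<close> is constant along \<open>a\<close>, the sign is chosen so
      that some constraint blocks the way. Otherwise the descending sign is forced, and boundedness
      of \<open>l\<close> from below supplies the blocking constraint.\<close>
    obtain h where h: "h = a \<or> h = - a" "l \<bullet> h \<le> 0" "\<exists>(g, \<beta>)\<in>H. g \<bullet> h > 0"
    proof (cases "l \<bullet> a = 0")
      case True
      obtain g where "g \<in> fst ` H" "g \<bullet> a \<noteq> 0"
        using eq_zero_if_orthogonal_to_spanning[OF sp, of a] a(1) by blast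
      then obtain \<beta> where gb: "(g, \<beta>) \<in> H" "g \<bullet> a \<noteq> 0" by auto
      show ?thesis
      proof (cases "g \<bullet> a > 0")
        case True
        then show ?thesis using that[of a] gb \<open>l \<bullet> a = 0\<close> by auto
      next
        case False
        then show ?thesis using that[of "- a"] gb \<open>l \<bullet> a = 0\<close> by force
      qed
    next
      case False
      define h where "h = (if l \<bullet> a < 0 then a else - a)"
      have lh: "l \<bullet> h < 0" using False by (auto simp: h_def)
      have "\<exists>(g, \<beta>)\<in>H. g \<bullet> h > 0"
      proof (rule ccontr)
        assume *: "\<not> ?thesis"
        \<comment> \<open>A step of this length would lower \<open>l\<close> from its value at
          \<open>v\<close> by |l v - m| + 1, hence below \<open>m\<close>.\<close>
        define t where "t = (\<bar>l \<bullet> v - m\<bar> + 1) / - (l \<bullet> h)"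
        have t: "t > 0" unfolding t_def by (rule divide_pos_pos) (use lh in auto)
        have "v + t *\<^sub>R h \<in> halfspaces_Int H"
          unfolding halfspaces_Int_def
        proof clarsimp
          fix g \<beta> assume g: "(g, \<beta>) \<in> H"
          then have "t * (g \<bullet> h) \<le> 0" using * t by (force simp: not_less intro: mult_nonneg_nonpos)
          moreover have "g \<bullet> v \<le> \<beta>" using v g by (auto simp: Q_def halfspaces_Int_def)
          ultimately show "g \<bullet> (v + t *\<^sub>R h) \<le> \<beta>" by (simp add: inner_add_right)
        qed
        then have "m \<le> l \<bullet> v + t * (l \<bullet> h)" using bdd by (force simp: inner_add_right)
        moreover have "t * (l \<bullet> h) = - (\<bar>l \<bullet> v - m\<bar> + 1)"
          using lh by (simp add: t_def field_simps)
        ultimately show False by linarith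
      qed
      then show ?thesis using that[of h] lh by (auto simp: h_def)
    qed
    obtain t where t: "t > 0" "v + t *\<^sub>R h \<in> halfspaces_Int H" "tight H v \<subset> tight H (v + t *\<^sub>R h)"
    proof (rule more_tight_along_direction[of H v h])
      show "finite H" "\<exists>(g, \<beta>)\<in>H. 0 < g \<bullet> h" by fact+
      show "v \<in> halfspaces_Int H" using v by (simp add: Q_def)
      show "g \<bullet> h = 0" if "(g, \<beta>) \<in> tight H v" for g \<beta> using tz[OF that] h(1) by auto
    qed blast
    have "t * (l \<bullet> h) \<le> 0" using t(1) h(2) by (simp add: mult_nonneg_nonpos)
    then have "Q (v + t *\<^sub>R h)" using t(2) v by (simp add: Q_def inner_add_right)
    then have "card (tight H (v + t *\<^sub>R h)) \<le> card (tight H v)" by (rule mx)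
    moreover have "card (tight H v) < card (tight H (v + t *\<^sub>R h))"
      using t(3) fin by (intro psubset_card_mono) (auto simp: tight_def intro: finite_subset[OF _ fin])
    ultimately show False by simp
  qed
  with v show ?thesis using that by (auto simp: Q_def is_vertex_def)
qed

lemma linear_min_at_vertex:
  fixes H :: "('a::euclidean_space \<times> real) set"
  assumes fin: "finite H" and sp: "span (fst ` H) = UNIV"
    and ne: "halfspaces_Int H \<noteq> {}" and bdd: "\<And>y. y \<in> halfspaces_Int H \<Longrightarrow> m \<le> l \<bullet> y"
  obtains v where "is_vertex H v" "\<And>y. y \<in> halfspaces_Int H \<Longrightarrow> l \<bullet> v \<le> l \<bullet> y"
proof -
  let ?V = "{x. is_vertex H x}"
  have "?V \<noteq> {}" using ne exists_vertex_below[OF fin sp _ bdd] by blast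
  with finite_vertices[OF fin] obtain v where v: "v \<in> ?V" "\<And>w. w \<in> ?V \<Longrightarrow> l \<bullet> v \<le> l \<bullet> w"
    using ex_is_arg_min_if_finite[of ?V "\<lambda>x. l \<bullet> x"] by (force simp: is_arg_min_linorder)
  have "l \<bullet> v \<le> l \<bullet> y" if y: "y \<in> halfspaces_Int H" for y
  proof -
    obtain w where "is_vertex H w" "l \<bullet> w \<le> l \<bullet> y"
      using exists_vertex_below[OF fin sp y bdd] .
    then show ?thesis using v(2)[of w] by simp
  qed
  then show ?thesis using v(1) that by simp
qed

section \<open>Splitting points of a spindle\<close>

text \<open>Submodularity of rank: the dimension formula for the sum of the two spans, whose
  intersection contains \<open>R\<close>.\<close>

lemma dim_Un_plus_le:
  fixes S T R :: "'a::euclidean_space set"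
  assumes "R \<subseteq> S" "R \<subseteq> T"
  shows "dim (S \<union> T) + dim R \<le> dim S + dim T"
proof -
  have "dim R \<le> dim (span S \<inter> span T)"
    by (rule dim_subset) (use assms in \<open>auto intro: span_base\<close>)
  moreover have "dim {x + y |x y. x \<in> span S \<and> y \<in> span T} + dim (span S \<inter> span T) = dim S + dim T"
    using dim_sums_Int[of "span S" "span T"] by simp
  moreover have "dim (S \<union> T) = dim {x + y |x y. x \<in> span S \<and> y \<in> span T}"
    using dim_span[of "S \<union> T"] by (simp only: span_Un)
  ultimately show ?thesis by linarith
qed

lemma span_eq_UNIV_mono:
  assumes "S \<subseteq> span T" "span S = UNIV"
  shows "span T = UNIV"
  using span_mono[OF assms(1)] assms(2) by (simp add: span_span top.extremum_unique)

text \<open>A vertex y of the spindle at which many constraints a j \<bullet> y \<le> a j \<bullet> x are tight, and which is lowest in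
  the direction of the sum of all a j, has to satisfy many of the constraints a j \<bullet> y \<ge> 0 with equality:
  otherwise some edge leads downwards from y without giving up the required upper constraints.\<close>

lemma spindle_split:
  fixes a :: "'m::finite \<Rightarrow> 'a::euclidean_space"
  assumes sp: "span (range a) = UNIV" and x: "\<And>j. 0 \<le> a j \<bullet> x"
    and de: "DIM('a) \<le> dim (a ` {j. a j \<bullet> x = 0}) + d + e"
  obtains y where "\<And>j. 0 \<le> a j \<bullet> y" "\<And>j. a j \<bullet> y \<le> a j \<bullet> x"
    "DIM('a) \<le> dim (a ` {j. a j \<bullet> y = 0}) + d"
    "DIM('a) \<le> dim (a ` {j. a j \<bullet> (x - y) = 0}) + e"
proof -
  define H :: "('a \<times> real) set" where "H = range (\<lambda>j. (- a j, 0)) \<union> range (\<lambda>j. (a j, a j \<bullet> x))"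
  \<comment> \<open>Since the \<open>a j\<close> span, \<open>l\<close> is positive on every nonzero
    point of the cone where they are all nonnegative. It therefore measures how far a point of the
    spindle is from 0.\<close>
  define l where "l = (\<Sum>j\<in>UNIV. a j)"
  define Z where "Z y = {j. a j \<bullet> y = 0}" for y
  define X where "X y = Z (x - y)" for y
  have mem_X: "j \<in> X y \<longleftrightarrow> a j \<bullet> y = a j \<bullet> x" for j y by (auto simp: X_def Z_def inner_diff_right)
  have mem_Z: "j \<in> Z y \<longleftrightarrow> a j \<bullet> y = 0" for j y by (simp add: Z_def)
  have finH: "finite H" by (simp add: H_def)
  have inH: "y \<in> halfspaces_Int H \<longleftrightarrow> (\<forall>j. 0 \<le> a j \<bullet> y \<and> a j \<bullet> y \<le> a j \<bullet> x)" for y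
    by (auto simp: H_def halfspaces_Int_def ball_Un)
  have tightH: "fst ` tight H y = (\<lambda>j. - a j) ` Z y \<union> a ` X y" for y
    by (force simp: H_def tight_def mem_X mem_Z)
  have l_pos: "l \<bullet> y > 0" if nn: "\<And>j. 0 \<le> a j \<bullet> y" "y \<noteq> 0" for y
  proof -
    obtain j where "a j \<bullet> y \<noteq> 0" using eq_zero_if_orthogonal_to_spanning[OF sp, of y] nn(2) by auto
    then have "0 < (\<Sum>j\<in>UNIV. a j \<bullet> y)"
      using nn(1) by (intro sum_pos2[of _ j]) (auto simp: order_less_le)
    then show ?thesis by (simp add: l_def inner_sum_left)
  qed
  \<comment> \<open>Candidates already satisfy the condition on \<open>x - y\<close>;
    \<open>x\<close> is one of them. Only the condition on \<open>y\<close> has to be forced by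
    minimality.\<close>
  let ?V = "{y. is_vertex H y \<and> DIM('a) \<le> dim (a ` X y) + e}"
  have "X x = UNIV" by (auto simp: mem_X)
  then have "range a \<subseteq> fst ` tight H x" by (simp add: tightH)
  then have "span (fst ` tight H x) = UNIV" using sp by (rule span_eq_UNIV_mono[OF order_trans[OF _ span_superset]])
  then have "x \<in> ?V" using x sp \<open>X x = UNIV\<close> by (simp add: is_vertex_def inH dim_eq_full[THEN iffD2])
  moreover have "finite ?V" using finite_vertices[OF finH] by (rule rev_finite_subset) auto
  ultimately obtain y where y: "is_vertex H y" "DIM('a) \<le> dim (a ` X y) + e"
    and ymin: "\<And>w. w \<in> ?V \<Longrightarrow> l \<bullet> y \<le> l \<bullet> w"
    using ex_is_arg_min_if_finite[of ?V "\<lambda>w. l \<bullet> w"] by (force simp: is_arg_min_linorder)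
  have y0: "0 \<le> a j \<bullet> y" "a j \<bullet> y \<le> a j \<bullet> x" for j using y(1) by (auto simp: is_vertex_def inH)
  have "DIM('a) \<le> dim (a ` Z y) + d"
  proof (rule ccontr)
    assume small: "\<not> ?thesis"
    have "y \<noteq> 0"
    proof
      assume "y = 0"
      then have "Z y = UNIV" by (auto simp: Z_def)
      with small sp show False by (simp add: dim_eq_full[THEN iffD2])
    qed
    then have ly: "l \<bullet> y > 0" using l_pos y0 by blast
    \<comment> \<open>Directions that keep the tight lower constraints at \<open>y\<close>, violate
      no tight upper one, and are scaled to decrease \<open>l\<close> by exactly 1. A vertex of this
      polyhedron is the direction of an edge of the face of the spindle cut out by
      \<open>Z y\<close>.\<close>
    define H2 :: "('a \<times> real) set" where "H2 = (\<lambda>j. (a j, 0)) ` Z y \<union> (\<lambda>j. (- a j, 0)) ` Z y \<union> (\<lambda>j. (a j, 0)) ` X y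
                           \<union> {(l, -1), (- l, 1)}"
    have inH2: "h \<in> halfspaces_Int H2 \<longleftrightarrow>
      (\<forall>j\<in>Z y. a j \<bullet> h = 0) \<and> (\<forall>j\<in>X y. a j \<bullet> h \<le> 0) \<and> l \<bullet> h = - 1" for h
      by (auto simp: H2_def halfspaces_Int_def ball_Un intro: antisym)
    have "fst ` tight H y \<subseteq> fst ` H2" unfolding tightH by (force simp: H2_def)
    then have sp2: "span (fst ` H2) = UNIV"
      by (rule span_eq_UNIV_mono[OF order_trans[OF _ span_superset]])
         (use y(1) in \<open>simp add: is_vertex_def\<close>)
    have fin2: "finite H2" by (simp add: H2_def)
    \<comment> \<open>The way straight to 0 is such a direction, so the polyhedron is not
      empty.\<close>
    have in2: "- (1 / (l \<bullet> y)) *\<^sub>R y \<in> halfspaces_Int H2"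
      using ly x by (auto simp: inH2 mem_Z mem_X)
    obtain h where h: "is_vertex H2 h"
      using exists_vertex_below[OF fin2 sp2 in2, of 0 0] by auto
    then have hZ: "\<And>j. j \<in> Z y \<Longrightarrow> a j \<bullet> h = 0" and hX: "\<And>j. j \<in> X y \<Longrightarrow> a j \<bullet> h \<le> 0" and hl: "l \<bullet> h = -1"
      by (auto simp: is_vertex_def inH2)
    define X' where "X' = {j \<in> X y. a j \<bullet> h = 0}"
    define W where "W = insert l (a ` Z y \<union> a ` X')"
    have "fst ` tight H2 h \<subseteq> W \<union> uminus ` W"
      by (auto simp: tight_def H2_def X'_def W_def)
    also have "\<dots> \<subseteq> span W" by (auto intro: span_base intro!: span_neg)
    finally have "fst ` tight H2 h \<subseteq> span (insert l (a ` Z y \<union> a ` X'))" by (simp add: W_def)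
    then have "span (insert l (a ` Z y \<union> a ` X')) = UNIV"
      by (rule span_eq_UNIV_mono) (use h in \<open>simp add: is_vertex_def\<close>)
    then have "DIM('a) \<le> dim (insert l (a ` Z y \<union> a ` X'))" by (simp add: dim_eq_full[THEN iffD2])
    also have "\<dots> \<le> dim (a ` Z y \<union> a ` X') + 1" by (simp add: dim_insert)
    finally have 1: "DIM('a) \<le> dim (a ` Z y \<union> a ` X') + 1" .
    have ZZ: "Z x \<subseteq> Z y"
    proof
      fix j assume "j \<in> Z x"
      then show "j \<in> Z y" using y0[of j] by (simp add: mem_Z)
    qed
    then have "Z x \<subseteq> X'" using hZ by (auto simp: X'_def mem_X mem_Z)
    \<comment> \<open>The rank count: one dimension is lost to \<open>l\<close>, but
      \<open>Z y\<close> has rank at most n - d - 1 by assumption, and the shared part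
      \<open>Z x\<close> has rank at least n - d - e. Submodularity leaves rank at least n - e for
      the upper constraints \<open>X'\<close> kept along the edge.\<close>
    with ZZ have "dim (a ` Z y \<union> a ` X') + dim (a ` Z x) \<le> dim (a ` Z y) + dim (a ` X')"
      by (intro dim_Un_plus_le) auto
    with 1 de small have X'big: "DIM('a) \<le> dim (a ` X') + e" unfolding Z_def by linarith
    \<comment> \<open>The face of the spindle on which the constraints of \<open>Z y\<close> and
      \<open>X'\<close> are equalities. A short step along \<open>h\<close> stays in it and lowers
      \<open>l\<close>; a vertex of this face below that point is a vertex of the spindle and again
      a candidate, contradicting the choice of \<open>y\<close>.\<close>
    define H3 :: "('a \<times> real) set" where "H3 = H \<union> (\<lambda>j. (a j, 0)) ` Z y \<union> (\<lambda>j. (- a j, - (a j \<bullet> x))) ` X'"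
    have inH3: "w \<in> halfspaces_Int H3 \<longleftrightarrow>
      w \<in> halfspaces_Int H \<and> (\<forall>j\<in>Z y. a j \<bullet> w \<le> 0) \<and> (\<forall>j\<in>X'. a j \<bullet> x \<le> a j \<bullet> w)" for w
      by (auto simp: H3_def halfspaces_Int_def ball_Un)
    have ev: "\<forall>\<^sub>F t in at_right (0::real). 0 \<le> a j \<bullet> (y + t *\<^sub>R h) \<and> a j \<bullet> (y + t *\<^sub>R h) \<le> a j \<bullet> x" for j
    proof (rule eventually_conj)
      have lim: "((\<lambda>t. a j \<bullet> (y + t *\<^sub>R h)) \<longlongrightarrow> a j \<bullet> (y + 0 *\<^sub>R h)) (at_right 0)"
        by (intro tendsto_intros)
      show "\<forall>\<^sub>F t in at_right (0::real). 0 \<le> a j \<bullet> (y + t *\<^sub>R h)"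
      proof (cases "j \<in> Z y")
        case True
        then show ?thesis using hZ by (simp add: inner_add_right mem_Z)
      next
        case False
        then have "0 < a j \<bullet> y" using y0[of j] by (simp add: mem_Z)
        then show ?thesis using order_tendstoD(1)[OF lim, of 0] by (auto elim: eventually_mono)
      qed
      show "\<forall>\<^sub>F t in at_right (0::real). a j \<bullet> (y + t *\<^sub>R h) \<le> a j \<bullet> x"
      proof (cases "j \<in> X y")
        case True
        then have "a j \<bullet> (y + t *\<^sub>R h) \<le> a j \<bullet> x" if "t > 0" for t
          using hX[of j] that by (simp add: inner_add_right mem_X mult_nonneg_nonpos)
        then show ?thesis by (simp add: eventually_at_right_less eventually_at_filter)
      next
        case False
        then have "a j \<bullet> y < a j \<bullet> x" using y0[of j] by (simp add: mem_X)
        then show ?thesis using order_tendstoD(2)[OF lim, of "a j \<bullet> x"] by (auto elim: eventually_mono)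
      qed
    qed
    have "\<forall>\<^sub>F t in at_right (0::real). (\<forall>j. 0 \<le> a j \<bullet> (y + t *\<^sub>R h) \<and> a j \<bullet> (y + t *\<^sub>R h) \<le> a j \<bullet> x) \<and> t > 0"
      by (intro eventually_conj eventually_all_finite ev eventually_at_right_less)
    then obtain t where t: "t > 0" "y + t *\<^sub>R h \<in> halfspaces_Int H"
      unfolding inH using eventually_happens'[of "at_right (0::real)"] trivial_limit_at_right_real by blast
    have t3: "y + t *\<^sub>R h \<in> halfspaces_Int H3"
      using t hZ by (auto simp: inH3 inner_add_right mem_Z X'_def mem_X)
    have "fst ` H \<subseteq> fst ` H3" by (auto simp: H3_def)
    moreover have "span (fst ` H) = UNIV"
    proof -
      have "range a \<subseteq> fst ` H" by (force simp: H_def)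
      then show ?thesis using sp by (rule span_eq_UNIV_mono[OF order_trans[OF _ span_superset]])
    qed
    ultimately have sp3: "span (fst ` H3) = UNIV" by (rule span_eq_UNIV_mono[OF order_trans[OF _ span_superset]])
    have fin3: "finite H3" using finH by (simp add: H3_def)
    have bdd: "0 \<le> l \<bullet> w" if "w \<in> halfspaces_Int H3" for w
      using that by (auto simp: inH3 inH l_def inner_sum_left intro!: sum_nonneg)
    obtain v where v: "is_vertex H3 v" "l \<bullet> v \<le> l \<bullet> (y + t *\<^sub>R h)"
      using exists_vertex_below[OF fin3 sp3 t3 bdd] .
    then have v3: "v \<in> halfspaces_Int H" "\<And>j. j \<in> Z y \<Longrightarrow> a j \<bullet> v \<le> 0" "\<And>j. j \<in> X' \<Longrightarrow> a j \<bullet> x \<le> a j \<bullet> v"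
      by (auto simp: is_vertex_def inH3)
    have v0: "0 \<le> a j \<bullet> v" "a j \<bullet> v \<le> a j \<bullet> x" for j using v3(1) by (auto simp: inH)
    have vX: "X' \<subseteq> X v"
    proof
      fix j assume "j \<in> X'"
      then show "j \<in> X v" using v3(3)[of j] v0[of j] by (simp add: mem_X)
    qed
    have vZ: "Z y \<subseteq> Z v"
    proof
      fix j assume "j \<in> Z y"
      then show "j \<in> Z v" using v3(2)[of j] v0[of j] by (simp add: mem_Z)
    qed
    have "fst ` tight H3 v \<subseteq> span (fst ` tight H v)"
    proof -
      let ?T = "span (fst ` tight H v)"
      have "a j \<in> ?T" if "j \<in> Z v" for j
        using that span_neg[OF span_base, of "- a j" "fst ` tight H v"] by (auto simp: tightH)
      then have "a ` Z y \<subseteq> ?T" using vZ by auto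
      moreover have "- a j \<in> ?T" if "j \<in> X v" for j
        using that span_neg[OF span_base, of "a j" "fst ` tight H v"] by (auto simp: tightH)
      then have "(\<lambda>j. - a j) ` X' \<subseteq> ?T" using vX by auto
      moreover have "fst ` tight H3 v \<subseteq> fst ` tight H v \<union> a ` Z y \<union> (\<lambda>j. - a j) ` X'"
        by (force simp: tight_def H3_def)
      ultimately show ?thesis by (elim order_trans) (intro Un_least span_superset)
    qed
    then have "span (fst ` tight H v) = UNIV"
      by (rule span_eq_UNIV_mono) (use v(1) in \<open>simp add: is_vertex_def\<close>)
    moreover have "dim (a ` X') \<le> dim (a ` X v)" using vX by (intro dim_subset) auto
    ultimately have "v \<in> ?V" using v3(1) X'big by (auto simp: is_vertex_def)
    then have "l \<bullet> y \<le> l \<bullet> v" by (rule ymin)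
    also have "\<dots> \<le> l \<bullet> y - t" using v(2) hl by (simp add: inner_add_right)
    finally show False using t by simp
  qed
  then show ?thesis using that[of y] y(2) y0 unfolding X_def Z_def by blast
qed

section \<open>Blichfeldt's theorem\<close>

definition int_vec :: "real^'n \<Rightarrow> bool" where "int_vec u \<longleftrightarrow> (\<forall>l. u $ l \<in> \<int>)"

text \<open>Cut \<open>S\<close> along the unit cells of the integer grid and translate all pieces
  \<open>F k\<close> into the unit cube. Disjoint translates would have total volume at most 1, so
  two of them overlap, and the two preimages of a common point differ by an integer vector.\<close>

lemma Blichfeldt:
  fixes S :: "(real^'n) set"
  assumes S: "S \<in> lmeasurable" and bS: "bounded S" and big: "measure lebesgue S > 1"
  obtains p q where "p \<in> S" "q \<in> S" "p \<noteq> q" "int_vec (p - q)"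
proof -
  define fl :: "real^'n \<Rightarrow> real^'n" where "fl w = (\<chi> l. of_int \<lfloor>w $ l\<rfloor>)" for w
  define F where "F k = S \<inter> {w. fl w = k}" for k
  define C where "C k = (\<lambda>w. - k + w) ` F k" for k
  let ?K = "fl ` S"
  obtain r where r: "\<And>w. w \<in> S \<Longrightarrow> norm w \<le> r" using bS by (auto simp: bounded_iff)
  have "?K \<subseteq> (\<lambda>g. \<chi> l. of_int (g l)) ` (PiE UNIV (\<lambda>_. {-\<lceil>r\<rceil> - 1..\<lceil>r\<rceil>}))"
  proof
    fix k assume "k \<in> ?K"
    then obtain w where w: "w \<in> S" "k = fl w" by auto
    have "\<lfloor>w $ l\<rfloor> \<in> {-\<lceil>r\<rceil> - 1..\<lceil>r\<rceil>}" for l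
    proof -
      have "\<bar>w $ l\<bar> \<le> r" using r[OF w(1)] component_le_norm_cart[of w l] by linarith
      then show ?thesis by (simp, intro conjI; linarith)
    qed
    then show "k \<in> (\<lambda>g. \<chi> l. of_int (g l)) ` (PiE UNIV (\<lambda>_. {-\<lceil>r\<rceil> - 1..\<lceil>r\<rceil>}))"
      using w by (intro image_eqI[of _ _ "\<lambda>l. \<lfloor>w $ l\<rfloor>"]) (auto simp: fl_def)
  qed
  then have finK: "finite ?K"
    by (rule finite_subset) (intro finite_imageI finite_PiE, auto)
  have cell: "{w. fl w = k} \<in> sets lebesgue" for k
  proof -
    have "{w. fl w = k} = {w::real^'n. \<forall>l. of_int \<lfloor>w $ l\<rfloor> = k $ l}"
      by (auto simp: fl_def vec_eq_iff)
    also have "\<dots> \<in> sets borel" by measurable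
    finally show ?thesis by simp
  qed
  have Fm: "F k \<in> lmeasurable" for k
    unfolding F_def by (intro fmeasurable_Int_fmeasurable S cell)
  have Cm: "C k \<in> lmeasurable" for k
    unfolding C_def using measurable_translation[OF Fm[of k], of "- k"] by simp
  have "measure lebesgue S = measure lebesgue (\<Union>k\<in>?K. F k)"
    by (rule arg_cong[of _ _ "measure lebesgue"]) (auto simp: F_def)
  also have "\<dots> = (\<Sum>k\<in>?K. measure lebesgue (F k))"
    by (rule measure_UNION'[OF finK Fm]) (auto simp: pairwise_def disjnt_def F_def)
  also have "\<dots> = (\<Sum>k\<in>?K. measure lebesgue (C k))"
    unfolding C_def using measure_translation by metis
  finally have sum: "measure lebesgue S = (\<Sum>k\<in>?K. measure lebesgue (C k))" .
  have "\<exists>k1\<in>?K. \<exists>k2\<in>?K. k1 \<noteq> k2 \<and> C k1 \<inter> C k2 \<noteq> {}"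
  proof (rule ccontr)
    assume "\<not> ?thesis"
    then have "pairwise (\<lambda>i j. disjnt (C i) (C j)) ?K" by (auto simp: pairwise_def disjnt_def)
    then have "(\<Sum>k\<in>?K. measure lebesgue (C k)) = measure lebesgue (\<Union>k\<in>?K. C k)"
      by (intro measure_UNION'[symmetric] finK Cm)
    also have "\<dots> \<le> measure lebesgue (cbox 0 (1::real^'n))"
    proof (rule measure_mono_fmeasurable)
      show "(\<Union>k\<in>?K. C k) \<subseteq> cbox 0 1"
      proof
        fix w assume "w \<in> (\<Union>k\<in>?K. C k)"
        then obtain k v where "v \<in> F k" "w = - k + v" by (auto simp: C_def)
        then have "w = v - fl v" by (simp add: F_def)
        then have "w $ l = v $ l - of_int \<lfloor>v $ l\<rfloor>" for l by (simp add: fl_def)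
        then show "w \<in> cbox 0 1" unfolding mem_box_cart 
          by (metis frac_def frac_ge_0 frac_lt_1 less_imp_le one_index zero_index)
      qed
      show "(\<Union>k\<in>?K. C k) \<in> sets lebesgue"
        by (intro sets.finite_UN finK fmeasurableD Cm)
    qed auto
    also have "\<dots> = 1"
      by (simp add: content_cbox_if_cart interval_eq_empty_cart)
    finally show False using sum big by simp
  qed
  then obtain k1 k2 v1 v2 where k: "k1 \<noteq> k2" "v1 \<in> F k1" "v2 \<in> F k2" "- k1 + v1 = - k2 + v2"
    by (auto simp: C_def)
  then have "v1 - v2 = k1 - k2" by (simp add: algebra_simps)
  moreover have "int_vec (k1 - k2)" using k by (auto simp: F_def fl_def int_vec_def)
  ultimately show ?thesis using k by (intro that[of v1 v2]) (auto simp: F_def)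
qed

section \<open>Determinants and volumes\<close>

text \<open>Cramer's rule, in the form that turns the maximality of a minor into a bound on the
  coefficients of the other rows.\<close>

lemma det_one_row_combination:
  fixes r :: "'n \<Rightarrow> real^'n" and \<xi> :: "'n \<Rightarrow> real"
  shows "det (\<chi> l. if l = k then \<Sum>m\<in>UNIV. \<xi> m *s r m else r l) = \<xi> k * det (\<chi> l. r l)"
  using cramer_lemma_transpose[of k "\<chi> m. \<xi> m" "\<chi> l. r l"] by (simp add: row_def vec_lambda_eta cong: if_cong)

text \<open>Replace row \<open>j\<close> first, which gives a new family \<open>s\<close>, and then
  row \<open>i\<close> after rewriting its combination in terms of \<open>s\<close>. This needs
  \<eta> j \<noteq> 0; the remaining case follows by linearity in row \<open>j\<close>.\<close>

lemma det_two_rows_combination: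
  fixes r :: "'n \<Rightarrow> real^'n" and \<xi> \<eta> :: "'n \<Rightarrow> real"
  assumes ij: "i \<noteq> j"
  shows "det (\<chi> l. if l = i then \<Sum>m\<in>UNIV. \<xi> m *s r m else if l = j then \<Sum>m\<in>UNIV. \<eta> m *s r m else r l)
       = (\<xi> i * \<eta> j - \<xi> j * \<eta> i) * det (\<chi> l. r l)"
proof -
  define D where "D w = det (\<chi> l. if l = i then \<Sum>m\<in>UNIV. \<xi> m *s r m else if l = j then w else r l)" for w
  have Dswap: "D w = det (\<chi> l. if l = j then w else if l = i then \<Sum>m\<in>UNIV. \<xi> m *s r m else r l)" for w
    unfolding D_def by (rule arg_cong[of _ _ det]) (use ij in \<open>auto simp: vec_eq_iff\<close>)
  have add: "D (w + w') = D w + D w'" for w w'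
    unfolding Dswap by (rule det_row_add)
  have nz: "D (\<Sum>m\<in>UNIV. \<eta> m *s r m) = (\<xi> i * \<eta> j - \<xi> j * \<eta> i) * det (\<chi> l. r l)"
    if "\<eta> j \<noteq> 0" for \<eta> :: "'n \<Rightarrow> real"
  proof -
    define w where "w = (\<Sum>m\<in>UNIV. \<eta> m *s r m)"
    define s where "s l = (if l = j then w else r l)" for l
    \<comment> \<open>Coefficients over \<open>s\<close> of the combination with coefficients \<xi>:
      solve the definition of \<open>w\<close> for \<open>r j\<close> and substitute.\<close>
    define \<zeta> where "\<zeta> m = (if m = j then \<xi> j / \<eta> j else \<xi> m - \<xi> j * \<eta> m / \<eta> j)" for m
    have "(\<Sum>m\<in>UNIV. \<zeta> m *s s m) = \<zeta> j *s w + (\<Sum>m\<in>UNIV - {j}. \<zeta> m *s r m)"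
      by (subst sum.remove[of UNIV j]) (simp_all add: s_def)
    also have "w = \<eta> j *s r j + (\<Sum>m\<in>UNIV - {j}. \<eta> m *s r m)"
      unfolding w_def by (rule sum.remove) simp_all
    also have "\<zeta> j *s (\<eta> j *s r j + (\<Sum>m\<in>UNIV - {j}. \<eta> m *s r m))
        = \<xi> j *s r j + (\<Sum>m\<in>UNIV - {j}. (\<xi> j * \<eta> m / \<eta> j) *s r m)"
      using that by (simp add: vec.scale_right_distrib vec.scale_sum_right \<zeta>_def)
    also have "\<dots> + (\<Sum>m\<in>UNIV - {j}. \<zeta> m *s r m)
        = \<xi> j *s r j + (\<Sum>m\<in>UNIV - {j}. (\<xi> j * \<eta> m / \<eta> j) *s r m + \<zeta> m *s r m)"
      by (simp only: sum.distrib add.assoc)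
    also have "(\<Sum>m\<in>UNIV - {j}. (\<xi> j * \<eta> m / \<eta> j) *s r m + \<zeta> m *s r m) = (\<Sum>m\<in>UNIV - {j}. \<xi> m *s r m)"
      by (intro sum.cong) (auto simp: \<zeta>_def vec.scale_left_distrib[symmetric])
    also have "\<xi> j *s r j + \<dots> = (\<Sum>m\<in>UNIV. \<xi> m *s r m)"
      by (rule sum.remove[symmetric]) simp_all
    finally have eq: "(\<Sum>m\<in>UNIV. \<xi> m *s r m) = (\<Sum>m\<in>UNIV. \<zeta> m *s s m)" ..
    have "D w = det (\<chi> l. if l = i then \<Sum>m\<in>UNIV. \<zeta> m *s s m else s l)"
      unfolding D_def eq s_def ..
    also have "\<dots> = \<zeta> i * det (\<chi> l. s l)" by (rule det_one_row_combination)
    also have "det (\<chi> l. s l) = \<eta> j * det (\<chi> l. r l)"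
      unfolding s_def w_def by (rule det_one_row_combination)
    finally have "D w = (\<zeta> i * \<eta> j) * det (\<chi> l. r l)" by simp
    also have "\<zeta> i * \<eta> j = \<xi> i * \<eta> j - \<xi> j * \<eta> i" using that ij by (simp add: \<zeta>_def field_simps)
    finally show ?thesis unfolding w_def .
  qed
  \<comment> \<open>If \<eta> j = 0, write \<eta> as the difference of \<eta> + e and e, both of
    which are nonzero at \<open>j\<close>.\<close>
  define e where "e m = (if m = j then 1 else 0::real)" for m
  have "D (\<Sum>m\<in>UNIV. \<eta> m *s r m) = (\<xi> i * \<eta> j - \<xi> j * \<eta> i) * det (\<chi> l. r l)"
  proof (cases "\<eta> j = 0")
    case True
    have "(\<Sum>m\<in>UNIV. (\<eta> m + e m) *s r m) = (\<Sum>m\<in>UNIV. \<eta> m *s r m) + (\<Sum>m\<in>UNIV. e m *s r m)"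
      by (simp only: vec.scale_left_distrib sum.distrib)
    then have "D (\<Sum>m\<in>UNIV. \<eta> m *s r m) = D (\<Sum>m\<in>UNIV. (\<eta> m + e m) *s r m) - D (\<Sum>m\<in>UNIV. e m *s r m)"
      by (simp only: add add_diff_cancel)
    also have "\<dots> = (\<xi> i * \<eta> j - \<xi> j * \<eta> i) * det (\<chi> l. r l)"
      using nz[of "\<lambda>m. \<eta> m + e m"] nz[of e] True ij by (simp add: e_def ring_distribs)
    finally show ?thesis .
  qed (rule nz)
  then show ?thesis by (simp add: D_def)
qed

lemma combination_of_basis_rows:
  fixes r :: "'n \<Rightarrow> real^'n"
  assumes "det (\<chi> l. r l) \<noteq> 0"
  obtains \<xi> where "v = (\<Sum>m\<in>UNIV. \<xi> m *s r m)"
proof -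
  let ?M = "(\<chi> l. r l) :: real^'n^'n"
  obtain N where N: "N ** ?M = mat 1" using assms by (auto simp: invertible_det_nz[symmetric] invertible_def)
  have "v = (v v* N) v* ?M" by (simp add: vector_matrix_mul_assoc N)
  also have "\<dots> = (\<Sum>m\<in>UNIV. ((v v* N) $ m) *s r m)"
    by (simp add: vec_eq_iff vector_matrix_mult_def mult.commute)
  finally show ?thesis by (rule that)
qed

text \<open>Same as measure_linear_image, but for an index type without a well-order.\<close>

lemma measure_linear_image_finite:
  fixes f :: "real^'n \<Rightarrow> real^'n"
  assumes "linear f" and "S \<in> lmeasurable"
  shows "f ` S \<in> lmeasurable \<and> measure lebesgue (f ` S) = \<bar>det (matrix f)\<bar> * measure lebesgue S"
proof -
  define P where "P f \<longleftrightarrow> (\<forall>S\<in>lmeasurable. f ` S \<in> lmeasurable \<and>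
      measure lebesgue (f ` S) = \<bar>det (matrix f)\<bar> * measure lebesgue S)" for f :: "real^'n \<Rightarrow> real^'n"
  have unimodular: "P h" if "linear h" "\<bar>det (matrix h)\<bar> = 1"
    "\<And>a b. cbox a b \<noteq> {} \<Longrightarrow> measure lebesgue (h ` cbox a b) = measure lebesgue (cbox a b)" for h
    unfolding P_def
  proof
    fix S :: "(real^'n) set" assume "S \<in> lmeasurable"
    moreover have "measure lebesgue (h ` cbox a b) = 1 * measure lebesgue (cbox a b)" for a b
      using that(3)[of a b] by (cases "cbox a b = {}") auto
    ultimately show "h ` S \<in> lmeasurable \<and> measure lebesgue (h ` S) = \<bar>det (matrix h)\<bar> * measure lebesgue S"
      using measure_linear_sufficient[OF that(1), of S 1] that(2) by simp
  qed
  have "P f"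
  proof (rule induct_linear_elementary[OF assms(1)])
    fix f g :: "real^'n \<Rightarrow> real^'n"
    assume "linear f" "linear g" "P f" "P g"
    then show "P (f \<circ> g)"
      by (simp only: P_def image_comp[symmetric] matrix_compose det_mul abs_mult mult.assoc) simp
  next
    fix f :: "real^'n \<Rightarrow> real^'n" and i
    assume f: "linear f" "\<And>x. f x $ i = 0"
    have "f ` S \<subseteq> {x. x $ i = 0}" for S using f by auto
    then have "negligible (f ` S)" for S
      using negligible_subset negligible_standard_hyperplane_cart by blast
    moreover have "row i (matrix f) = 0" using f(2) by (simp add: row_def matrix_def vec_eq_iff)
    then have "det (matrix f) = 0" by (rule det_zero_row)
    ultimately show "P f" by (simp add: P_def negligible_iff_measure)
  next
    fix c :: "'n \<Rightarrow> real"
    show "P (\<lambda>x. \<chi> i. c i * x $ i)"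
      by (simp add: P_def measurable_stretch measure_stretch matrix_def det_diagonal axis_def)
  next
    fix m n :: 'n assume mn: "m \<noteq> n"
    let ?t = "Transposition.transpose m n"
    let ?h = "\<lambda>x::real^'n. \<chi> i. x $ ?t i"
    show "P ?h"
    proof (rule unimodular)
      show "linear ?h" by (rule linearI) (simp_all add: vec_eq_iff)
      have "matrix ?h = (\<chi> i. mat 1 $ ?t i)"
        by (auto simp: matrix_def axis_def mat_def vec_eq_iff)
      then have "det (matrix ?h) = of_int (sign ?t) * det (mat 1 :: real^'n^'n)"
        using det_permute_rows[of ?t "mat 1"] by (simp add: permutes_swap_id)
      then show "\<bar>det (matrix ?h)\<bar> = 1" by (simp add: abs_mult sign_def)
      fix a b :: "real^'n" assume ne: "cbox a b \<noteq> {}"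
      have "?h ` cbox a b = cbox (?h a) (?h b)"
      proof (intro equalityI subsetI)
        fix y assume y: "y \<in> cbox (?h a) (?h b)"
        then have "?h y \<in> cbox a b"
          by (auto simp: mem_box_cart) (metis transpose_involutory)+
        moreover have "y = ?h (?h y)" by (simp add: vec_eq_iff)
        ultimately show "y \<in> ?h ` cbox a b" by blast
      qed (auto simp: mem_box_cart)
      moreover have "cbox (?h a) (?h b) \<noteq> {}" using ne calculation by blast
      moreover have "(\<Prod>i\<in>UNIV. b $ ?t i - a $ ?t i) = (\<Prod>i\<in>UNIV. b $ i - a $ i)"
        by (rule prod.reindex_bij_betw[of ?t, OF bij_transpose])
      ultimately show "measure lebesgue (?h ` cbox a b) = measure lebesgue (cbox a b)"
        using ne by (simp add: content_cbox_if_cart)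
    qed
  next
    fix m n :: 'n assume mn: "m \<noteq> n"
    let ?h = "\<lambda>x::real^'n. \<chi> i. if i = m then x $ m + x $ n else x $ i"
    show "P ?h"
    proof (rule unimodular)
      show lin: "linear ?h" by (rule linearI) (auto simp: vec_eq_iff algebra_simps)
      have "matrix ?h = (\<chi> k. if k = m then row m (mat 1) + 1 *s row n (mat 1) else row k (mat 1))"
        using mn by (auto simp: matrix_def axis_def mat_def row_def vec_eq_iff)
      then show "\<bar>det (matrix ?h)\<bar> = 1" using det_row_operation[OF mn, of "mat 1 :: real^'n^'n" 1] by (simp only: det_I abs_one)
      fix a b :: "real^'n" assume ne: "cbox a b \<noteq> {}"
      let ?v = "\<chi> i. if i = n then - a $ n else 0"
      have "?h ` (+) ?v ` cbox a b = (+) (?h ?v) ` ?h ` cbox a b"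
        unfolding image_image by (intro image_cong refl) (simp add: linear_add[OF lin])
      then have "measure lebesgue (?h ` cbox a b) = measure lebesgue (?h ` (+) ?v ` cbox a b)"
        by (simp add: measure_translation)
      also have "(+) ?v ` cbox a b = cbox (?v + a) (?v + b)" by (rule cbox_translation[symmetric])
      also have "measure lebesgue (?h ` \<dots>) = measure lebesgue (cbox (?v + a) (?v + b))"
        by (rule measure_shear_interval[OF mn]) (use ne in \<open>simp_all add: cbox_translation\<close>)
      also have "\<dots> = measure lebesgue (cbox a b)"
        by (simp only: cbox_translation measure_translation)
      finally show "measure lebesgue (?h ` cbox a b) = measure lebesgue (cbox a b)" .
    qed
  qed
  with assms(2) show ?thesis by (simp add: P_def)
qed

lemma measure_matrix_preimage:
  fixes M :: "real^'n^'n"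
  assumes M: "det M \<noteq> 0" and Q: "Q \<in> lmeasurable"
  shows "{w. M *v w \<in> Q} \<in> lmeasurable"
    and "measure lebesgue {w. M *v w \<in> Q} = measure lebesgue Q / \<bar>det M\<bar>"
proof -
  obtain N where N: "N ** M = mat 1" "M ** N = mat 1" using M by (auto simp: invertible_det_nz[symmetric] invertible_def)
  have eq: "{w. M *v w \<in> Q} = (*v) N ` Q"
  proof safe
    fix w assume "M *v w \<in> Q"
    moreover have "w = N *v (M *v w)" by (simp add: matrix_vector_mul_assoc N)
    ultimately show "w \<in> (*v) N ` Q" by blast
  qed (simp add: matrix_vector_mul_assoc N)
  have "det N * det M = 1" using N by (metis det_I det_mul)
  then have "\<bar>det N\<bar> = 1 / \<bar>det M\<bar>" using M by (simp add: field_simps flip: abs_mult)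
  then show "measure lebesgue {w. M *v w \<in> Q} = measure lebesgue Q / \<bar>det M\<bar>"
    unfolding eq using measure_linear_image_finite[OF matrix_vector_mul_linear Q, of N] by simp
  show "{w. M *v w \<in> Q} \<in> lmeasurable"
    unfolding eq using measure_linear_image_finite[OF matrix_vector_mul_linear Q, of N] by simp
qed

section \<open>The area of a polar polygon\<close>

definition det2 :: "real \<times> real \<Rightarrow> real \<times> real \<Rightarrow> real" where
  "det2 X Y = fst X * snd Y - snd X * fst Y"

text \<open>A planar set in the coordinates \<open>i\<close>, \<open>j\<close> times a box in the
  others. Planar areas occur only as volumes of such prisms in \<open>real^'n\<close>, so areas in
  the plane and volumes in space need not be related by a product measure.\<close>

definition prism :: "'n \<Rightarrow> 'n \<Rightarrow> ('n \<Rightarrow> real) \<Rightarrow> (real \<times> real) set \<Rightarrow> (real^'n) set" where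
  "prism i j h E = {z. (\<forall>l. l \<noteq> i \<longrightarrow> l \<noteq> j \<longrightarrow> \<bar>z $ l\<bar> < h l) \<and> (z $ i, z $ j) \<in> E}"

text \<open>The interior of the triangle with vertices 0, X, Y when X and Y are independent.\<close>

definition open_triangle :: "real \<times> real \<Rightarrow> real \<times> real \<Rightarrow> (real \<times> real) set" where
  "open_triangle X Y = {\<alpha> *\<^sub>R X + \<beta> *\<^sub>R Y |\<alpha> \<beta>. 0 < \<alpha> \<and> 0 < \<beta> \<and> \<alpha> + \<beta> < 1}"

lemma open_prism:
  assumes "open E"
  shows "open (prism i j h E)"
proof -
  have "prism i j h E = (\<Inter>l\<in>UNIV - {i, j}. {z. \<bar>z $ l\<bar> < h l}) \<inter> (\<lambda>z. (z $ i, z $ j)) -` E"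
    by (auto simp: prism_def)
  moreover have "open {z::real^'a. \<bar>z $ l\<bar> < h l}" for l
    by (intro open_Collect_less continuous_intros)
  moreover have "open ((\<lambda>z::real^'a. (z $ i, z $ j)) -` E)"
    by (intro open_vimage assms continuous_intros)
  ultimately show ?thesis by (auto intro!: open_INT)
qed

lemma bounded_prism:
  fixes i j :: "'n::finite"
  assumes "bounded E"
  shows "bounded (prism i j h E)"
proof -
  obtain B where B: "\<And>s. s \<in> E \<Longrightarrow> norm s \<le> B" using assms by (auto simp: bounded_iff)
  have "\<bar>z $ l\<bar> \<le> \<bar>h l\<bar> + \<bar>B\<bar>" if z: "z \<in> prism i j h E" for z l
  proof (cases "l = i \<or> l = j")
    case True
    have "norm (z $ i, z $ j) \<le> B" using z B by (simp add: prism_def)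
    then show ?thesis using True norm_fst_le[of "z $ i" "z $ j"] norm_snd_le[of "z $ j" "z $ i"] by auto
  next
    case False
    then show ?thesis using z by (force simp: prism_def)
  qed
  then have "prism i j h E \<subseteq> cbox (\<chi> l. - (\<bar>h l\<bar> + \<bar>B\<bar>)) (\<chi> l. \<bar>h l\<bar> + \<bar>B\<bar>)"
    by (auto simp: mem_box_cart abs_le_iff) (smt (verit))+
  then show ?thesis using bounded_cbox bounded_subset by blast
qed

text \<open>The triangle, its reflection in the centre of the unit square and the diagonal cover the
  open square. The reflection preserves volume and the diagonal is negligible, so the triangle gets
  at least half.\<close>

lemma measure_prism_unit_triangle:
  fixes i j :: "'n::finite"
  assumes ij: "i \<noteq> j" and h: "\<And>l. 0 < h l"
  shows "prism i j h (open_triangle (1, 0) (0, 1)) \<in> lmeasurable"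
    and "(\<Prod>l\<in>UNIV - {i, j}. 2 * h l) / 2 \<le> measure lebesgue (prism i j h (open_triangle (1, 0) (0, 1)))"
proof -
  let ?T = "prism i j h (open_triangle (1, 0) (0, 1))"
  let ?c = "axis i 1 + axis j 1 :: real^'n"
  let ?a = "\<chi> l. if l = i \<or> l = j then 0 else - h l"
  let ?b = "\<chi> l. if l = i \<or> l = j then 1 else h l"
  let ?N = "{z. ?c \<bullet> z = 1}"
  have tri: "open_triangle (1, 0) (0, 1) = {s. 0 < fst s \<and> 0 < snd s \<and> fst s + snd s < 1}"
    by (auto simp: open_triangle_def)
  have "bounded (open_triangle (1, 0) (0, 1))"
    by (rule bounded_subset[OF bounded_cbox[of "(0, 0)" "(1, 1)"]]) (auto simp: tri cbox_Pair_eq)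
  moreover have "open (open_triangle (1, 0) (0, 1))"
    unfolding tri by (intro open_Collect_conj open_Collect_less continuous_intros)
  ultimately show T: "?T \<in> lmeasurable"
    by (intro lmeasurable_open bounded_prism open_prism)
  have neg: "negligible ?N"
    by (rule negligible_hyperplane) (auto simp: vec_eq_iff axis_def)
  have dot: "?c \<bullet> z = z $ i + z $ j" for z :: "real^'n" by (simp add: inner_add_left inner_axis')
  have "box ?a ?b \<subseteq> ?T \<union> (\<lambda>z. (- 1) *\<^sub>R z + ?c) ` ?T \<union> ?N"
  proof
    fix z assume z: "z \<in> box ?a ?b"
    have zl: "\<bar>z $ l\<bar> < h l" if "l \<noteq> i" "l \<noteq> j" for l
      using z that by (auto simp: mem_box_cart abs_less_iff) (smt (verit))+
    have zij: "0 < z $ i" "z $ i < 1" "0 < z $ j" "z $ j < 1" using z by (auto simp: mem_box_cart) (smt (verit))+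
    consider "z $ i + z $ j < 1" | "z $ i + z $ j > 1" | "z $ i + z $ j = 1" by linarith
    then show "z \<in> ?T \<union> (\<lambda>z. (- 1) *\<^sub>R z + ?c) ` ?T \<union> ?N"
    proof cases
      case 1
      then have "z \<in> ?T" using zl zij by (auto simp: prism_def tri)
      then show ?thesis by blast
    next
      case 2
      have "?c - z \<in> ?T" using 2 zl zij ij by (auto simp: prism_def tri axis_def)
      moreover have "z = (- 1) *\<^sub>R (?c - z) + ?c" by simp
      ultimately show ?thesis by blast
    qed (simp add: dot)
  qed
  moreover have T': "(\<lambda>z. (- 1) *\<^sub>R z + ?c) ` ?T \<in> lmeasurable"
  proof -
    have "(\<lambda>z. (- 1) *\<^sub>R z + ?c) ` ?T = (+) ?c ` uminus ` ?T" by (auto simp: image_image)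
    moreover have "linear (uminus :: real^'n \<Rightarrow> _)" by (rule linearI) auto
    ultimately show ?thesis using measure_linear_image_finite[of uminus ?T] T measurable_translation by metis
  qed
  moreover have N: "?N \<in> lmeasurable" "measure lebesgue ?N = 0" using neg by (auto simp: negligible_iff_measure)
  ultimately have "measure lebesgue (box ?a ?b) \<le> measure lebesgue (?T \<union> (\<lambda>z. (- 1) *\<^sub>R z + ?c) ` ?T \<union> ?N)"
    using T by (intro measure_mono_fmeasurable) (auto intro!: fmeasurable.Un)
  also have "\<dots> \<le> measure lebesgue (?T \<union> (\<lambda>z. (- 1) *\<^sub>R z + ?c) ` ?T) + measure lebesgue ?N"
    using T T' N by (intro measure_Un_le) (auto intro: fmeasurableD)
  also have "\<dots> \<le> measure lebesgue ?T + measure lebesgue ((\<lambda>z. (- 1) *\<^sub>R z + ?c) ` ?T) + measure lebesgue ?N"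
    using T T' by (intro add_right_mono measure_Un_le) (auto intro: fmeasurableD)
  also have "\<dots> = 2 * measure lebesgue ?T"
    using measure_lebesgue_affine[of "-1" ?c ?T] N by simp
  also have "measure lebesgue (box ?a ?b) = (\<Prod>l\<in>UNIV. ?b $ l - ?a $ l)"
  proof -
    have "?a $ l \<le> ?b $ l" for l using h[of l] by simp
    then show ?thesis
      using content_cbox_cart[of ?a ?b] measure_lborel_box_eq[of ?a ?b] measure_lborel_cbox_eq[of ?a ?b]
      by (simp add: interval_ne_empty_cart)
  qed
  also have "\<dots> = (\<Prod>l\<in>UNIV - {i, j}. 2 * h l)"
    by (rule prod.mono_neutral_cong_right) auto
  finally show "(\<Prod>l\<in>UNIV - {i, j}. 2 * h l) / 2 \<le> measure lebesgue ?T" by simp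
qed

text \<open>The prism is the image of the one over the unit triangle under the linear map that sends
  the two planar axis vectors to X and Y and fixes the other axes; its determinant is
  \<open>det2 X Y\<close>.\<close>

lemma measure_prism_triangle:
  fixes i j :: "'n::finite"
  assumes ij: "i \<noteq> j" and h: "\<And>l. 0 < h l"
  shows "prism i j h (open_triangle X Y) \<in> lmeasurable"
    and "\<bar>det2 X Y\<bar> / 2 * (\<Prod>l\<in>UNIV - {i, j}. 2 * h l) \<le> measure lebesgue (prism i j h (open_triangle X Y))"
proof -
  let ?T = "prism i j h (open_triangle (1, 0) (0, 1))"
  let ?L = "\<lambda>z::real^'n. \<chi> l. if l = i then z $ i * fst X + z $ j * fst Y
              else if l = j then z $ i * snd X + z $ j * snd Y else z $ l"
  define \<xi> where "\<xi> m = (if m = i then fst X else if m = j then fst Y else 0)" for m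
  define \<eta> where "\<eta> m = (if m = i then snd X else if m = j then snd Y else 0)" for m
  have lin: "linear ?L" by (rule linearI) (auto simp: vec_eq_iff algebra_simps)
  have img: "?L ` ?T = prism i j h (open_triangle X Y)"
  proof (intro equalityI subsetI)
    fix w assume "w \<in> ?L ` ?T"
    then show "w \<in> prism i j h (open_triangle X Y)"
      using ij by (cases X; cases Y) (force simp: prism_def open_triangle_def)
  next
    fix w assume w: "w \<in> prism i j h (open_triangle X Y)"
    then obtain \<alpha> \<beta> where ab: "0 < \<alpha>" "0 < \<beta>" "\<alpha> + \<beta> < 1" "(w $ i, w $ j) = \<alpha> *\<^sub>R X + \<beta> *\<^sub>R Y"
      by (auto simp: prism_def open_triangle_def)
    define z where "z = (\<chi> l. if l = i then \<alpha> else if l = j then \<beta> else w $ l)"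
    have "z \<in> ?T" using w ab ij by (auto simp: z_def prism_def open_triangle_def)
    moreover have "w = ?L z"
      using ab(4) ij by (cases X; cases Y) (auto simp: z_def vec_eq_iff)
    ultimately show "w \<in> ?L ` ?T" by blast
  qed
  have "matrix ?L = (\<chi> l. if l = i then \<Sum>m\<in>UNIV. \<xi> m *s axis m 1
      else if l = j then \<Sum>m\<in>UNIV. \<eta> m *s axis m 1 else axis l 1)"
    using ij by (auto simp: matrix_def vec_eq_iff axis_def \<xi>_def \<eta>_def if_distrib[of "\<lambda>x. _ * x"] cong: if_cong)
  then have "det (matrix ?L) = (\<xi> i * \<eta> j - \<xi> j * \<eta> i) * det ((\<chi> l. axis l 1) :: real^'n^'n)"
    using det_two_rows_combination[OF ij, of \<xi> "\<lambda>l. axis l 1" \<eta>] by simp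
  also have "((\<chi> l. axis l 1) :: real^'n^'n) = mat 1" by (auto simp: mat_def axis_def vec_eq_iff)
  finally have det: "det (matrix ?L) = det2 X Y" using ij by (simp add: \<xi>_def \<eta>_def det2_def algebra_simps)
  note * = measure_linear_image_finite[OF lin measure_prism_unit_triangle(1)[OF ij, of h, OF h]]
  show "prism i j h (open_triangle X Y) \<in> lmeasurable" using * by (simp only: img)
  have "\<bar>det2 X Y\<bar> * ((\<Prod>l\<in>UNIV - {i, j}. 2 * h l) / 2) \<le> \<bar>det2 X Y\<bar> * measure lebesgue ?T"
    by (intro mult_left_mono measure_prism_unit_triangle ij h) auto
  also have "\<dots> = measure lebesgue (prism i j h (open_triangle X Y))"
    using * by (simp only: img det)
  finally show "\<bar>det2 X Y\<bar> / 2 * (\<Prod>l\<in>UNIV - {i, j}. 2 * h l) \<le> measure lebesgue (prism i j h (open_triangle X Y))"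
    by simp
qed

text \<open>For \<open>det2 X Y > 0\<close> this is the open convex cone spanned by X and Y.\<close>

definition open_sector :: "real \<times> real \<Rightarrow> real \<times> real \<Rightarrow> (real \<times> real) set" where
  "open_sector X Y = {s. 0 < det2 X s \<and> 0 < det2 s Y}"

lemma open_open_sector: "open (open_sector X Y)"
  unfolding open_sector_def det2_def by (intro open_Collect_conj open_Collect_less continuous_intros)

lemma prism_mono: "E \<subseteq> E' \<Longrightarrow> prism i j h E \<subseteq> prism i j h E'"
  by (auto simp: prism_def)

lemma disjnt_prism: "E \<inter> E' = {} \<Longrightarrow> disjnt (prism i j h E) (prism i j h E')"
  by (auto simp: prism_def disjnt_def)

text \<open>The triangles 0, X, A and 0, A, Y lie on different sides of the line through A and have
  areas a d / (2e) and b d / (2e). Since a + b = 1 the total d / (2e) does not depend on how A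
  divides the sector.\<close>

lemma measure_prism_sector:
  fixes i j :: "'n::finite"
  assumes ij: "i \<noteq> j" and h: "\<And>l. 0 < h l"
    and E: "open E" "bounded E"
    and triE: "\<And>X' Y'. \<lbrakk>X' \<in> {X, Y, A}; Y' \<in> {X, Y, A}\<rbrakk> \<Longrightarrow> open_triangle X' Y' \<subseteq> E"
    and d: "det2 X Y = d" "0 < d" and A: "A = (b / e) *\<^sub>R X + (a / e) *\<^sub>R Y"
    and ab: "0 \<le> a" "0 \<le> b" "a + b = 1" and e: "0 < e"
  shows "d / (2 * e) * (\<Prod>l\<in>UNIV - {i, j}. 2 * h l) \<le> measure lebesgue (prism i j h (E \<inter> open_sector X Y))"
proof -
  define p where "p = (\<Prod>l\<in>UNIV - {i, j}. 2 * h l)"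
  have p: "0 < p" unfolding p_def using h by (intro prod_pos) auto
  \<comment> \<open>If \<open>a = 0\<close>, then A is a multiple of X and the degenerate triangle
    lies on the boundary ray, outside the open sector; the empty set replaces it. The same is done
    for \<open>T2\<close>.\<close>
  define T1 where "T1 = (if 0 < a then open_triangle X A else {})"
  define T2 where "T2 = (if 0 < b then open_triangle A Y else {})"
  have XA: "det2 X A = a * d / e" "det2 A Y = b * d / e"
    using d by (simp_all add: A det2_def algebra_simps add_divide_distrib[symmetric] diff_divide_distrib[symmetric])
  have [simp]: "det2 Z Z = 0" for Z by (simp add: det2_def)
  have lin: "det2 Z (\<alpha> *\<^sub>R V + \<beta> *\<^sub>R W) = \<alpha> * det2 Z V + \<beta> * det2 Z W"
    "det2 (\<alpha> *\<^sub>R V + \<beta> *\<^sub>R W) Z = \<alpha> * det2 V Z + \<beta> * det2 W Z" for Z V W \<alpha> \<beta>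
    by (simp_all add: det2_def algebra_simps)
  have T1: "T1 \<subseteq> E \<inter> open_sector X Y \<inter> {s. 0 < det2 s A}"
  proof (cases "0 < a")
    case True
    have "s \<in> open_sector X Y \<inter> {s. 0 < det2 s A}" if s: "s \<in> open_triangle X A" for s
    proof -
      obtain \<alpha> \<beta> where *: "0 < \<alpha>" "0 < \<beta>" "s = \<alpha> *\<^sub>R X + \<beta> *\<^sub>R A" using s by (auto simp: open_triangle_def)
      show ?thesis using * True ab d e
        by (auto simp: open_sector_def lin XA intro!: add_pos_nonneg mult_pos_pos divide_pos_pos mult_nonneg_nonneg divide_nonneg_pos)
    qed
    then show ?thesis using triE[of X A] True by (auto simp: T1_def)
  qed (simp add: T1_def)
  have T2: "T2 \<subseteq> E \<inter> open_sector X Y \<inter> {s. det2 s A < 0}"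
  proof (cases "0 < b")
    case True
    have "s \<in> open_sector X Y \<inter> {s. det2 s A < 0}" if s: "s \<in> open_triangle A Y" for s
    proof -
      obtain \<alpha> \<beta> where *: "0 < \<alpha>" "0 < \<beta>" "s = \<alpha> *\<^sub>R A + \<beta> *\<^sub>R Y" using s by (auto simp: open_triangle_def)
      have "det2 Y A = - (b * d / e)" using XA(2) unfolding det2_def by (simp add: mult.commute[of "fst Y"] mult.commute[of "snd Y"])
      then show ?thesis using * True ab d e
        by (auto simp: open_sector_def lin XA intro!: add_nonneg_pos mult_pos_pos divide_pos_pos mult_nonneg_nonneg divide_nonneg_pos)
    qed
    then show ?thesis using triE[of A Y] True by (auto simp: T2_def)
  qed (simp add: T2_def)
  have m1: "prism i j h T1 \<in> lmeasurable" "a * d / (2 * e) * p \<le> measure lebesgue (prism i j h T1)"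
  proof -
    have e0: "prism i j h {} = {}" by (simp add: prism_def)
    show "prism i j h T1 \<in> lmeasurable"
      using measure_prism_triangle(1)[OF ij, of h X A] h by (simp add: T1_def e0)
    show "a * d / (2 * e) * p \<le> measure lebesgue (prism i j h T1)"
      using measure_prism_triangle(2)[OF ij, of h X A] h XA ab d e
      by (cases "0 < a") (auto simp: T1_def e0 p_def mult_ac)
  qed
  have m2: "prism i j h T2 \<in> lmeasurable" "b * d / (2 * e) * p \<le> measure lebesgue (prism i j h T2)"
  proof -
    have e0: "prism i j h {} = {}" by (simp add: prism_def)
    show "prism i j h T2 \<in> lmeasurable"
      using measure_prism_triangle(1)[OF ij, of h A Y] h by (simp add: T2_def e0)
    show "b * d / (2 * e) * p \<le> measure lebesgue (prism i j h T2)"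
      using measure_prism_triangle(2)[OF ij, of h A Y] h XA ab d e
      by (cases "0 < b") (auto simp: T2_def e0 p_def mult_ac)
  qed
  have "d / (2 * e) * p = a * d / (2 * e) * p + b * d / (2 * e) * p"
  proof -
    have "d = a * d + b * d" using ab(3) by (simp add: distrib_right[symmetric])
    then show ?thesis by (simp add: add_divide_distrib[symmetric] distrib_right[symmetric])
  qed
  also have "\<dots> \<le> measure lebesgue (prism i j h T1) + measure lebesgue (prism i j h T2)"
    using m1 m2 by linarith
  also have "\<dots> = measure lebesgue (prism i j h T1 \<union> prism i j h T2)"
  proof (rule measure_Union[symmetric])
    have "T1 \<inter> T2 = {}" using T1 T2 by fastforce
    then show "prism i j h T1 \<inter> prism i j h T2 = {}" using disjnt_prism[of T1 T2 i j h] by (simp add: disjnt_def)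
  qed (use m1 m2 in \<open>auto simp: fmeasurable_def\<close>)
  also have "\<dots> \<le> measure lebesgue (prism i j h (E \<inter> open_sector X Y))"
  proof (rule measure_mono_fmeasurable)
    have "T1 \<union> T2 \<subseteq> E \<inter> open_sector X Y" using T1 T2 by blast
    then show "prism i j h T1 \<union> prism i j h T2 \<subseteq> prism i j h (E \<inter> open_sector X Y)"
      using prism_mono by (metis Un_subset_iff)
    show "prism i j h (E \<inter> open_sector X Y) \<in> lmeasurable"
      by (intro lmeasurable_open bounded_prism open_prism open_Int E open_open_sector bounded_Int) (simp add: E)
  qed (use m1 m2 in \<open>auto intro: fmeasurableD\<close>)
  finally show ?thesis unfolding p_def .
qed

text \<open>\<open>N\<close> is the norm whose unit ball is the polar of \<open>P\<close>, and
  \<open>g\<close> runs along its unit circle from (1, 0) through the upper half to (-1, 0). The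
  \<open>N\<close>-distance from (1, 0) grows from 0 to 2, so it is 1 at some inner point
  \<open>q\<close>. The functionals \<pi>q and \<pi>r attain the norms of q and q - (1, 0).\<close>

lemma hexagon_exists:
  fixes P :: "(real \<times> real) set"
  assumes fin: "finite P" and e: "(1, 0) \<in> P" "(0, 1) \<in> P"
    and det: "\<And>\<pi> \<pi>'. \<lbrakk>\<pi> \<in> P; \<pi>' \<in> P\<rbrakk> \<Longrightarrow> \<bar>det2 \<pi> \<pi>'\<bar> \<le> 1"
  obtains q \<pi>q \<pi>r where "\<And>\<pi>. \<pi> \<in> P \<Longrightarrow> \<bar>\<pi> \<bullet> q\<bar> \<le> 1" "\<And>\<pi>. \<pi> \<in> P \<Longrightarrow> \<bar>\<pi> \<bullet> (q - (1, 0))\<bar> \<le> 1"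
    "0 < snd q" "\<pi>q \<in> P" "\<bar>\<pi>q \<bullet> q\<bar> = 1" "\<pi>r \<in> P" "\<bar>\<pi>r \<bullet> (q - (1, 0))\<bar> = 1"
proof -
  define N where "N s = Max ((\<lambda>\<pi>. \<bar>\<pi> \<bullet> s\<bar>) ` P)" for s
  have ne: "P \<noteq> {}" using e by auto
  have N_ge: "\<bar>\<pi> \<bullet> s\<bar> \<le> N s" if "\<pi> \<in> P" for \<pi> s unfolding N_def using that fin by (intro Max_ge) auto
  have N_in: "\<exists>\<pi>\<in>P. \<bar>\<pi> \<bullet> s\<bar> = N s" for s
  proof -
    have "N s \<in> (\<lambda>\<pi>. \<bar>\<pi> \<bullet> s\<bar>) ` P" unfolding N_def using fin ne by (intro Max_in) auto
    then show ?thesis by auto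
  qed
  have N_scale: "N (c *\<^sub>R s) = \<bar>c\<bar> * N s" for c s
  proof (rule antisym)
    obtain \<pi> where "\<pi> \<in> P" "\<bar>\<pi> \<bullet> (c *\<^sub>R s)\<bar> = N (c *\<^sub>R s)" using N_in by blast
    then show "N (c *\<^sub>R s) \<le> \<bar>c\<bar> * N s" using mult_left_mono[OF N_ge[of \<pi> s], of "\<bar>c\<bar>"] by (simp add: abs_mult)
    obtain \<pi> where "\<pi> \<in> P" "\<bar>\<pi> \<bullet> s\<bar> = N s" using N_in by blast
    then show "\<bar>c\<bar> * N s \<le> N (c *\<^sub>R s)" using N_ge[of \<pi> "c *\<^sub>R s"] by (auto simp: abs_mult)
  qed
  have N_e1: "N (1, 0) = 1"
  proof (rule antisym)
    obtain \<pi> where "\<pi> \<in> P" "\<bar>\<pi> \<bullet> (1, 0)\<bar> = N (1, 0)" using N_in by blast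
    then show "N (1, 0) \<le> 1" using det[OF _ e(2), of \<pi>] by (cases \<pi>) (auto simp: det2_def)
  qed (use N_ge[OF e(1), of "(1, 0)"] in simp)
  have N_pos: "0 < N s" if "s \<noteq> 0" for s
    using N_ge[OF e(1), of s] N_ge[OF e(2), of s] that by (cases s) (auto simp: zero_prod_def)
  have cont: "continuous_on UNIV N"
  proof -
    have "continuous_on UNIV (\<lambda>s. Max ((\<lambda>\<pi>. \<bar>\<pi> \<bullet> s\<bar>) ` F))" if "finite F" "F \<noteq> {}" for F :: "(real \<times> real) set"
      using that
    proof (induction F rule: finite_ne_induct)
      case (insert x F)
      then have eq: "(\<lambda>s. Max ((\<lambda>\<pi>. \<bar>\<pi> \<bullet> s\<bar>) ` insert x F)) = (\<lambda>s. max \<bar>x \<bullet> s\<bar> (Max ((\<lambda>\<pi>. \<bar>\<pi> \<bullet> s\<bar>) ` F)))"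
        by (intro ext) simp
      show ?case unfolding eq by (intro continuous_intros insert.IH)
    qed (auto intro!: continuous_intros)
    then show ?thesis unfolding N_def using fin ne by blast
  qed
  define s where "s t = (cos t, sin t)" for t :: real
  define g where "g t = (1 / N (s t)) *\<^sub>R s t" for t
  have s0: "s t \<noteq> 0" for t
    using sin_zero_norm_cos_one[of t] by (auto simp: s_def zero_prod_def)
  have cs: "continuous_on S s" for S unfolding s_def by (intro continuous_intros)
  have cN: "continuous_on S (\<lambda>t. N (f t))" if "continuous_on S f" for S :: "real set" and f
    using continuous_on_compose2[OF cont that] by simp
  have cg: "continuous_on S g" for S
    unfolding g_def using N_pos[OF s0] by (intro continuous_intros cs cN) (auto simp: less_imp_neq[symmetric])
  have "\<exists>t\<ge>0. t \<le> pi \<and> N (g t - (1, 0)) = 1"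
  proof (rule IVT')
    have "g 0 - (1, 0) = 0" by (simp add: g_def s_def N_e1 zero_prod_def)
    then show "N (g 0 - (1, 0)) \<le> 1" using N_scale[of 0 0] by simp
    have "N (-1, 0) = 1" using N_scale[of "-1" "(1, 0)"] N_e1 by simp
    then have "g pi - (1, 0) = (-2) *\<^sub>R (1, 0)" by (simp add: g_def s_def)
    then show "1 \<le> N (g pi - (1, 0))" by (simp only: N_scale N_e1)
    show "continuous_on {0..pi} (\<lambda>t. N (g t - (1, 0)))" by (intro cN continuous_intros cg)
  qed auto
  then obtain t where t: "0 \<le> t" "t \<le> pi" "N (g t - (1, 0)) = 1" by auto
  have Ng: "N (g t) = 1" using N_pos[OF s0, of t] by (simp add: g_def N_scale)
  have "t \<noteq> 0"
  proof
    assume "t = 0"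
    then have "g t - (1, 0) = 0" by (simp add: g_def s_def N_e1 zero_prod_def)
    then show False using t(3) N_scale[of 0 0] by simp
  qed
  moreover have "t \<noteq> pi"
  proof
    have "N (-1, 0) = 1" using N_scale[of "-1" "(1, 0)"] N_e1 by simp
    moreover assume "t = pi"
    ultimately have "g t - (1, 0) = (-2) *\<^sub>R (1, 0)" by (simp add: g_def s_def)
    then have "N (g t - (1, 0)) = 2" by (simp only: N_scale N_e1)
    then show False using t(3) by simp
  qed
  ultimately have "0 < snd (g t)" using t N_pos[OF s0, of t] by (simp add: g_def s_def sin_gt_zero)
  moreover obtain \<pi>q where "\<pi>q \<in> P" "\<bar>\<pi>q \<bullet> g t\<bar> = 1" using N_in[of "g t"] Ng by auto
  moreover obtain \<pi>r where "\<pi>r \<in> P" "\<bar>\<pi>r \<bullet> (g t - (1, 0))\<bar> = 1" using N_in[of "g t - (1, 0)"] t(3) by auto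
  ultimately show ?thesis
    using that[of "g t" \<pi>q \<pi>r] N_ge[of _ "g t"] N_ge[of _ "g t - (1, 0)"] Ng t(3) by simp
qed

text \<open>Let N be the norm with dual unit ball spanned by P, so that E is half the open unit ball. Pick p = (1,0)
  and q with N p = N q = N (q - p) = 1. For each edge of the hexagon with vertices p, q, q - p and their
  negatives, the member of P supporting the opposite pair of vertices, rotated by a right angle, is a vector of
  norm at most 1 lying over that edge; with the origin and the two vertices of the edge it spans area 1/2,
  whatever the area of the hexagon is. Hence the unit ball has area at least 3.\<close>

lemma measure_prism_polar:
  fixes i j :: "'n::finite" and P :: "(real \<times> real) set"
  assumes fin: "finite P" and e: "(1, 0) \<in> P" "(0, 1) \<in> P"
    and det: "\<And>\<pi> \<pi>'. \<lbrakk>\<pi> \<in> P; \<pi>' \<in> P\<rbrakk> \<Longrightarrow> \<bar>det2 \<pi> \<pi>'\<bar> \<le> 1"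
    and ij: "i \<noteq> j" and h: "\<And>l. 0 < h l"
  defines "E \<equiv> {s. \<forall>\<pi>\<in>P. \<bar>\<pi> \<bullet> s\<bar> < 1 / 2}"
  shows "open E" "bounded E"
    and "3 / 4 * (\<Prod>l\<in>UNIV - {i, j}. 2 * h l) \<le> measure lebesgue (prism i j h E)"
proof -
  define c where "c = (\<Prod>l\<in>UNIV - {i, j}. 2 * h l)"
  have "E = (\<Inter>\<pi>\<in>P. {s. \<bar>\<pi> \<bullet> s\<bar> < 1 / 2})" by (auto simp: E_def)
  then show oE: "open E" using fin by (auto intro!: open_INT open_Collect_less continuous_intros)
  show bE: "bounded E"
    by (rule bounded_subset[OF bounded_cbox[of "(-1, -1)" "(1, 1)"]]) (use e in \<open>force simp: E_def cbox_Pair_eq\<close>)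
  define W where "W = {s. \<forall>\<pi>\<in>P. \<bar>\<pi> \<bullet> s\<bar> \<le> 1 / 2}"
  have triE: "open_triangle X Y \<subseteq> E" if "X \<in> W" "Y \<in> W" for X Y
  proof
    fix s assume "s \<in> open_triangle X Y"
    then obtain \<alpha> \<beta> where *: "0 < \<alpha>" "0 < \<beta>" "\<alpha> + \<beta> < 1" "s = \<alpha> *\<^sub>R X + \<beta> *\<^sub>R Y"
      by (auto simp: open_triangle_def)
    have "\<bar>\<pi> \<bullet> s\<bar> < 1 / 2" if "\<pi> \<in> P" for \<pi>
    proof -
      have "\<bar>\<pi> \<bullet> s\<bar> \<le> \<alpha> * \<bar>\<pi> \<bullet> X\<bar> + \<beta> * \<bar>\<pi> \<bullet> Y\<bar>"
        using *(1,2) abs_triangle_ineq[of "\<alpha> * (\<pi> \<bullet> X)" "\<beta> * (\<pi> \<bullet> Y)"] by (simp add: *(4) inner_add_right abs_mult)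
      also have "\<dots> \<le> \<alpha> * (1 / 2) + \<beta> * (1 / 2)"
        using * \<open>X \<in> W\<close> \<open>Y \<in> W\<close> \<open>\<pi> \<in> P\<close> by (intro add_mono mult_left_mono) (auto simp: W_def)
      also have "\<dots> < 1 / 2" using *(3) by simp
      finally show ?thesis .
    qed
    then show "s \<in> E" by (simp add: E_def)
  qed
  have Wneg: "- X \<in> W" if "X \<in> W" for X using that by (simp add: W_def)
  obtain q \<pi>q \<pi>r where q: "\<And>\<pi>. \<pi> \<in> P \<Longrightarrow> \<bar>\<pi> \<bullet> q\<bar> \<le> 1" "\<And>\<pi>. \<pi> \<in> P \<Longrightarrow> \<bar>\<pi> \<bullet> (q - (1, 0))\<bar> \<le> 1"
    "0 < snd q" "\<pi>q \<in> P" "\<bar>\<pi>q \<bullet> q\<bar> = 1" "\<pi>r \<in> P" "\<bar>\<pi>r \<bullet> (q - (1, 0))\<bar> = 1"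
    using hexagon_exists[OF fin e det] by blast
  define d where "d = snd q"
  define x where "x = fst q"
  have qxd: "q = (x, d)" by (simp add: x_def d_def)
  have d: "0 < d" using q(3) by (simp add: d_def)
  \<comment> \<open>Everything is scaled by 1/2, because a difference of two points of E will be
    used: \<open>u\<close> and \<open>v\<close> are halves of the hexagon vertices p and q.\<close>
  define u :: "real \<times> real" where "u = (1 / 2, 0)"
  define v where "v = (1 / 2) *\<^sub>R q"
  have fst1: "\<bar>fst \<pi>\<bar> \<le> 1" if "\<pi> \<in> P" for \<pi> using det[OF that e(2)] by (simp add: det2_def)
  have W: "u \<in> W" "v \<in> W" "v - u \<in> W"
    using fst1 q(1,2) by (auto simp: W_def u_def v_def qxd inner_prod_def right_diff_distrib abs_mult field_simps)
  have Wrot: "(1 / 2) *\<^sub>R (snd \<pi>, - fst \<pi>) \<in> W" if "\<pi> \<in> P" for \<pi>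
  proof -
    have "\<bar>\<pi>' \<bullet> (1 / 2) *\<^sub>R (snd \<pi>, - fst \<pi>)\<bar> \<le> 1 / 2" if "\<pi>' \<in> P" for \<pi>'
    proof -
      have "\<pi>' \<bullet> (1 / 2) *\<^sub>R (snd \<pi>, - fst \<pi>) = det2 \<pi>' \<pi> / 2" by (simp add: inner_prod_def det2_def)
      then show ?thesis using det[OF \<open>\<pi>' \<in> P\<close> \<open>\<pi> \<in> P\<close>] by simp
    qed
    then show ?thesis by (simp add: W_def)
  qed
  \<comment> \<open>The determinant bound puts the rotated members of \<open>P\<close> into
    \<open>W\<close>. Their coordinates over \<open>u\<close>, \<open>v\<close> have denominator
    \<open>d\<close>, which is what makes the area of the hexagon cancel below.\<close>
  have rot: "(1 / 2) *\<^sub>R (snd \<pi>, - fst \<pi>) = ((\<pi> \<bullet> q) / d) *\<^sub>R u - (fst \<pi> / d) *\<^sub>R v" for \<pi>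
    using d by (simp add: u_def v_def qxd inner_prod_def field_simps)
  \<comment> \<open>All six edges of the halved hexagon have \<open>det2 X Y = d / 4\<close>, so
    each sector contributes (d / 4) / (2 d) = 1 / 8.\<close>
  have sec: "1 / 8 * c \<le> measure lebesgue (prism i j h (E \<inter> open_sector X Y))"
    if XY: "X \<in> W" "Y \<in> W" "A \<in> W" "det2 X Y = d / 4" "A = (b / d) *\<^sub>R X + (a / d) *\<^sub>R Y"
      "0 \<le> a" "0 \<le> b" "a + b = 1" for X Y A a b
  proof -
    have "(d / 4) / (2 * d) * c \<le> measure lebesgue (prism i j h (E \<inter> open_sector X Y))"
      unfolding c_def
    proof (rule measure_prism_sector[OF ij h oE bE _ XY(4) _ XY(5)])
      show "open_triangle X' Y' \<subseteq> E" if "X' \<in> {X, Y, A}" "Y' \<in> {X, Y, A}" for X' Y'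
        by (rule triE) (use that XY(1,2,3) in blast)+
    qed (use XY(6,7,8) d in simp_all)
    then show ?thesis using d by simp
  qed
  have sec2: "1 / 8 * c \<le> measure lebesgue (prism i j h (E \<inter> open_sector X Y)) \<and>
              1 / 8 * c \<le> measure lebesgue (prism i j h (E \<inter> open_sector (- X) (- Y)))"
    if XY: "X \<in> W" "Y \<in> W" "A \<in> W" "det2 X Y = d / 4" "A = (b / d) *\<^sub>R X + (a / d) *\<^sub>R Y"
      "0 \<le> a" "0 \<le> b" "a + b = 1" for X Y A a b
  proof (intro conjI sec[OF XY] sec[of "- X" "- Y" "- A" b a] Wneg XY(1,2,3,6,7,8))
    show "det2 (- X) (- Y) = d / 4" using XY(4) by (simp add: det2_def)
    show "- A = (b / d) *\<^sub>R - X + (a / d) *\<^sub>R - Y" by (simp add: XY(5))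
  qed
  define \<sigma> where "\<sigma> = \<pi>r \<bullet> (q - (1, 0))"
  have \<sigma>: "\<sigma> = 1 \<or> \<sigma> = -1" using q(7) by (auto simp: \<sigma>_def)
  have "\<pi>r \<bullet> q - fst \<pi>r = \<sigma>" by (simp add: \<sigma>_def inner_diff_right inner_prod_def[of \<pi>r "(1, 0)"])
  then have \<sigma>': "\<sigma> * (\<pi>r \<bullet> q) - \<sigma> * fst \<pi>r = 1" using \<sigma> by auto
  \<comment> \<open>Edge from p to q; \<pi>r supports the vertex q - p. The sign \<sigma> makes the
    two weights add up to 1, and since neither exceeds 1 in absolute value, both are
    nonnegative.\<close>
  have s1: "1 / 8 * c \<le> measure lebesgue (prism i j h (E \<inter> open_sector u v)) \<and>
              1 / 8 * c \<le> measure lebesgue (prism i j h (E \<inter> open_sector (- u) (- v)))"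
  proof (rule sec2[of _ _ "\<sigma> *\<^sub>R (1 / 2) *\<^sub>R (snd \<pi>r, - fst \<pi>r)" "\<sigma> * (\<pi>r \<bullet> q)" "- \<sigma> * fst \<pi>r"])
    show "\<sigma> *\<^sub>R (1 / 2) *\<^sub>R (snd \<pi>r, - fst \<pi>r) \<in> W"
      using \<sigma> Wrot[OF q(6)] Wneg[OF Wrot[OF q(6)]] by (elim disjE) simp_all
    show "\<sigma> *\<^sub>R (1 / 2) *\<^sub>R (snd \<pi>r, - fst \<pi>r) = (\<sigma> * (\<pi>r \<bullet> q) / d) *\<^sub>R u + (- \<sigma> * fst \<pi>r / d) *\<^sub>R v"
      unfolding rot by (simp add: scaleR_diff_right)
    show "0 \<le> - \<sigma> * fst \<pi>r" "0 \<le> \<sigma> * (\<pi>r \<bullet> q)"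
      using \<sigma> \<sigma>' fst1[OF q(6)] q(1)[OF q(6)] by auto
  qed (use W \<sigma>' in \<open>auto simp: det2_def u_def v_def qxd\<close>)
  have x: "0 \<le> x" "x \<le> 1" using q(1)[OF e(1)] q(2)[OF e(1)] by (auto simp: qxd)
  \<comment> \<open>Edge from q to q - p; the functional (1, 0) supports p. The weights 1 - x and x
    are nonnegative because |x| \<le> 1 and |x - 1| \<le> 1.\<close>
  have s2: "1 / 8 * c \<le> measure lebesgue (prism i j h (E \<inter> open_sector v (v - u))) \<and>
              1 / 8 * c \<le> measure lebesgue (prism i j h (E \<inter> open_sector (- v) (- (v - u))))"
  proof (rule sec2[of _ _ "- (1 / 2) *\<^sub>R (0, -1)" "1 - x" x])
    show "- (1 / 2) *\<^sub>R (0, -1) \<in> W" using Wneg[OF Wrot[OF e(1)]] by simp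
  qed (use W x d in \<open>auto simp: det2_def u_def v_def qxd field_simps\<close>)
  define \<tau> where "\<tau> = \<pi>q \<bullet> q"
  have \<tau>: "\<tau> = 1 \<or> \<tau> = -1" using q(5) by (auto simp: \<tau>_def)
  have \<tau>': "\<tau> * (\<pi>q \<bullet> q) = 1" using \<tau> unfolding \<tau>_def by auto
  \<comment> \<open>Edge from q - p to -p; \<pi>q supports q. Nonnegativity of the weights comes
    from the bounds on \<pi>q at p and at q - p.\<close>
  have s3: "1 / 8 * c \<le> measure lebesgue (prism i j h (E \<inter> open_sector (v - u) (- u))) \<and>
              1 / 8 * c \<le> measure lebesgue (prism i j h (E \<inter> open_sector (- (v - u)) (- (- u))))"
  proof (rule sec2[of _ _ "- \<tau> *\<^sub>R (1 / 2) *\<^sub>R (snd \<pi>q, - fst \<pi>q)" "\<tau> * fst \<pi>q" "1 - \<tau> * fst \<pi>q"])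
    show "- \<tau> *\<^sub>R (1 / 2) *\<^sub>R (snd \<pi>q, - fst \<pi>q) \<in> W"
      using \<tau> Wrot[OF q(4)] Wneg[OF Wrot[OF q(4)]] by (elim disjE) simp_all
    have "- \<tau> *\<^sub>R (1 / 2) *\<^sub>R (snd \<pi>q, - fst \<pi>q) = - ((\<tau> * (\<pi>q \<bullet> q)) / d) *\<^sub>R u + (\<tau> * fst \<pi>q / d) *\<^sub>R v"
      unfolding rot by (simp add: scaleR_diff_right)
    also have "\<dots> = (\<tau> * fst \<pi>q / d) *\<^sub>R (v - u) + ((1 - \<tau> * fst \<pi>q) / d) *\<^sub>R (- u)"
      unfolding \<tau>' by (simp add: scaleR_diff_right diff_divide_distrib scaleR_diff_left)
    finally show "- \<tau> *\<^sub>R (1 / 2) *\<^sub>R (snd \<pi>q, - fst \<pi>q) = \<dots>" .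
    have "\<bar>\<pi>q \<bullet> q - fst \<pi>q\<bar> \<le> 1" using q(2)[OF q(4)] by (simp add: inner_diff_right inner_prod_def[of \<pi>q "(1, 0)"])
    then show "0 \<le> \<tau> * fst \<pi>q" "0 \<le> 1 - \<tau> * fst \<pi>q"
      using \<tau> \<tau>' fst1[OF q(4)] by auto
    show "- u \<in> W" using W(1) by (rule Wneg)
  qed (use W in \<open>auto simp: det2_def u_def v_def qxd\<close>)
  define S where "S k = (if k = 0 then E \<inter> open_sector u v else if k = 1 then E \<inter> open_sector v (v - u)
      else if k = 2 then E \<inter> open_sector (v - u) (- u) else if k = 3 then E \<inter> open_sector (- u) (- v)
      else if k = 4 then E \<inter> open_sector (- v) (- (v - u)) else E \<inter> open_sector (- (v - u)) u)" for k :: nat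
  \<comment> \<open>The signs of \<open>det2 u s\<close>, \<open>det2 v s\<close> and of their
    difference \<open>det2 (v - u) s\<close> tell in which of the six sectors \<open>s\<close> lies,
    so the sectors are disjoint.\<close>
  define idx :: "real \<times> real \<Rightarrow> nat" where "idx s = (let m = det2 u s; n = det2 v s in
      if 0 < m then (if n < 0 then 0 else if n < m then 1 else 2)
      else (if 0 < n then 3 else if m < n then 4 else 5))" for s
  let ?I = "{0, 1, 2, 3, 4, 5::nat}"
  have idx: "idx s = k" if "k \<in> ?I" "s \<in> S k" for s k
    using that by (auto simp: S_def idx_def Let_def open_sector_def det2_def algebra_simps split: if_splits)
  have meas: "prism i j h (S k) \<in> lmeasurable" for k
    using oE bE by (auto simp: S_def intro!: lmeasurable_open bounded_prism open_prism open_open_sector bounded_Int)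
  have "3 / 4 * c \<le> (\<Sum>k\<in>?I. measure lebesgue (prism i j h (S k)))"
    using s1 s2 s3 by (simp add: S_def)
  also have "\<dots> = measure lebesgue (\<Union>k\<in>?I. prism i j h (S k))"
  proof (rule measure_UNION'[symmetric])
    show "pairwise (\<lambda>k m. disjnt (prism i j h (S k)) (prism i j h (S m))) ?I"
    proof (intro pairwiseI disjnt_prism equals0I)
      fix k m s assume k: "k \<in> ?I" and m: "m \<in> ?I" and "k \<noteq> m" and s: "s \<in> S k \<inter> S m"
      then show False using idx[OF k, of s] idx[OF m, of s] by simp
    qed
  qed (simp_all add: meas)
  also have "\<dots> \<le> measure lebesgue (prism i j h E)"
  proof (rule measure_mono_fmeasurable)
    show "(\<Union>k\<in>?I. prism i j h (S k)) \<subseteq> prism i j h E"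
      by (intro UN_least prism_mono) (auto simp: S_def)
    show "(\<Union>k\<in>?I. prism i j h (S k)) \<in> sets lebesgue"
      by (intro sets.finite_UN fmeasurableD meas) simp
    show "prism i j h E \<in> lmeasurable" by (intro lmeasurable_open bounded_prism open_prism oE bE)
  qed
  finally show "3 / 4 * (\<Prod>l\<in>UNIV - {i, j}. 2 * h l) \<le> measure lebesgue (prism i j h E)" by (simp add: c_def)
qed

section \<open>Points on low-dimensional faces\<close>

text \<open>The preimage of \<open>Q\<close> under the matrix with rows \<open>s l\<close> has
  volume above 1, so Blichfeldt's theorem applies. Both points \<open>z\<close>, \<open>z'\<close>
  are returned: bounding a functional at each of them by half the desired bound replaces the
  symmetry and convexity assumptions of Minkowski's theorem.\<close>

lemma lattice_point_of_large_preimage: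
  fixes s :: "'n::finite \<Rightarrow> real^'n"
  assumes det: "det (\<chi> l. s l) \<noteq> 0" and Q: "Q \<in> lmeasurable" "bounded Q"
    and big: "\<bar>det (\<chi> l. s l)\<bar> < measure lebesgue Q"
  obtains u z z' where "int_vec u" "u \<noteq> 0" "z \<in> Q" "z' \<in> Q" "\<And>l. s l \<bullet> u = z $ l - z' $ l"
proof -
  let ?M = "(\<chi> l. s l) :: real^'n^'n"
  let ?S = "{w. ?M *v w \<in> Q}"
  have Mw: "(?M *v w) $ l = s l \<bullet> w" for w l
    by (simp add: matrix_vector_mul_component)
  obtain N where N: "N ** ?M = mat 1" using det by (auto simp: invertible_det_nz[symmetric] invertible_def)
  have "?S \<subseteq> (*v) N ` Q"
  proof
    fix w assume "w \<in> ?S"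
    moreover have "w = N *v (?M *v w)" by (simp add: matrix_vector_mul_assoc N)
    ultimately show "w \<in> (*v) N ` Q" by blast
  qed
  then have "bounded ?S"
    using bounded_linear_image[OF Q(2) matrix_vector_mul_bounded_linear] bounded_subset by blast
  moreover have "1 < measure lebesgue ?S"
    using measure_matrix_preimage(2)[OF det Q(1)] big det by simp
  ultimately obtain p q where pq: "p \<in> ?S" "q \<in> ?S" "p \<noteq> q" "int_vec (p - q)"
    using Blichfeldt measure_matrix_preimage(1)[OF det Q(1)] by blast
  show ?thesis
    by (rule that[of "p - q" "?M *v p" "?M *v q"]) (use pq in \<open>auto simp: Mw inner_diff_right\<close>)
qed

text \<open>Choose n - k independent rows vanishing at \<open>y\<close>. Their span does not contain
  \<open>a i\<close>, which is nonzero at \<open>y\<close>, so all of them together extend to a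
  basis of rows; \<open>N\<close> collects the k positions not taken by the chosen rows.\<close>

lemma basis_rows:
  fixes a :: "'m::finite \<Rightarrow> real^'n"
  assumes sp: "span (range a) = UNIV" and y: "a i \<bullet> y \<noteq> 0"
    and k: "CARD('n) \<le> dim (a ` {j. a j \<bullet> y = 0}) + k" "1 \<le> k" "k \<le> CARD('n)"
  obtains f :: "'n \<Rightarrow> 'm" and N i0 where "card N = k" "i0 \<in> N" "f i0 = i"
    "det (\<chi> l. a (f l)) \<noteq> 0" "\<And>l. l \<notin> N \<Longrightarrow> a (f l) \<bullet> y = 0"
proof -
  let ?Z = "a ` {j. a j \<bullet> y = 0}"
  obtain B1 where B1: "B1 \<subseteq> ?Z" "independent B1" "card B1 = dim ?Z" using basis_exists by metis
  have "CARD('n) - k \<le> card B1" using k B1(3) by simp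
  then obtain R where R: "R \<subseteq> B1" "card R = CARD('n) - k"
    by (meson obtain_subset_with_card_n)
  have Ry: "w \<bullet> y = 0" if "w \<in> R" for w using that R B1 by auto
  have "span R \<subseteq> {w. w \<bullet> y = 0}"
    by (rule span_minimal) (use Ry in \<open>auto simp: subspace_def inner_add_left\<close>)
  then have "a i \<notin> span R" using y by auto
  then have ind: "independent (insert (a i) R)"
    using R(1) B1(2) independent_mono independent_insertI by blast
  have "insert (a i) R \<subseteq> range a" using R B1 by auto
  then obtain B where B: "insert (a i) R \<subseteq> B" "B \<subseteq> range a" "independent B" "range a \<subseteq> span B"
    using ind by (rule maximal_independent_subset_extend)
  have spB: "span B = UNIV" using span_eq_UNIV_mono[OF B(4) sp] .
  have finB: "finite B" using B(3) independent_imp_finite by blast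
  have "card B = CARD('n)"
    using dim_eq_card[of B UNIV] B(3) spB by (simp add: dim_UNIV)
  then obtain g where g: "bij_betw g (UNIV :: 'n set) B" using finite_same_card_bij finB by (metis finite_class.finite_UNIV)
  \<comment> \<open>Several indices may carry the same row; the case distinction makes the position
    of \<open>a i\<close> receive the index \<open>i\<close> itself.\<close>
  define f where "f l = (if g l = a i then i else SOME j. a j = g l)" for l
  have af: "a (f l) = g l" for l
  proof -
    have "g l \<in> range a" using g B(2) by (auto simp: bij_betw_def)
    then have "\<exists>j. a j = g l" by auto
    then have "a (SOME j. a j = g l) = g l" by (rule someI_ex)
    then show ?thesis by (simp add: f_def)
  qed
  define N where "N = {l. g l \<notin> R}"
  obtain i0 where i0: "g i0 = a i" using g B(1) by (metis bij_betw_iff_bijections insert_subset)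
  have "bij_betw g (- N) R"
    using g R B(1) unfolding N_def bij_betw_def by (auto simp: inj_on_def)
  then have "card (- N) = CARD('n) - k" using R(2) by (simp add: bij_betw_same_card)
  then have "card N = k" using k(3) card_Un_disjoint[of N "- N"] by (simp add: Compl_partition)
  moreover have "i0 \<in> N" using i0 Ry[of "a i"] y by (auto simp: N_def)
  moreover have "f i0 = i" by (simp add: f_def i0)
  moreover have "det (\<chi> l. a (f l)) \<noteq> 0"
  proof -
    let ?M = "(\<chi> l. a (f l)) :: real^'n^'n"
    have "rows ?M = B"
      using g by (auto simp: rows_def row_def af bij_betw_def vec_lambda_eta)
    then have "\<exists>N. N ** ?M = mat 1" using matrix_left_invertible_span_rows[of ?M] spB by simp
    then show ?thesis by (simp add: invertible_det_nz[symmetric] invertible_left_inverse)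
  qed
  moreover have "a (f l) \<bullet> y = 0" if "l \<notin> N" for l using that Ry by (simp add: N_def af)
  ultimately show ?thesis using that by blast
qed

text \<open>Minimality of z seen from z: an admissible integer step cannot move in the positive
  direction of row \<open>i\<close>. The slack 1 is what integrality of the constraints gives away
  for free. As \<open>y\<close> occurs only in the upper bounds, the property passes to points with
  smaller values a_j y.\<close>

definition no_step :: "('m \<Rightarrow> real^'n) \<Rightarrow> 'm \<Rightarrow> real^'n \<Rightarrow> bool" where
  "no_step a i y \<longleftrightarrow> (\<forall>u. int_vec u \<longrightarrow> (\<forall>j. - 1 < a j \<bullet> u \<and> a j \<bullet> u < a j \<bullet> y + 1) \<longrightarrow> a i \<bullet> u \<le> 0)"

lemma Ints_inner_int_vec: "int_vec v \<Longrightarrow> int_vec u \<Longrightarrow> v \<bullet> u \<in> \<int>"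
  by (auto simp: int_vec_def inner_vec_def intro!: Ints_sum Ints_mult)

lemma Ints_less_1_eq_0: "x \<in> \<int> \<Longrightarrow> \<bar>x\<bar> < 1 \<Longrightarrow> x = (0::real)"
  by (auto elim!: Ints_cases)

text \<open>Write u = \<theta> y + t. Integrality of a_i u and the bound with the floor give
  |\<theta>| \<le> 1, and -u may replace u. If all |a_j t| < 1, then for \<theta> > 0 the step u is
  forbidden, while for \<theta> = 0 the integers a_j u all vanish and u = 0.\<close>

lemma no_near_lattice_point:
  fixes a :: "'m::finite \<Rightarrow> real^'n"
  assumes ints: "\<And>j. int_vec (a j)" and sp: "span (range a) = UNIV"
    and y: "\<And>j. 0 \<le> a j \<bullet> y" and no: "no_step a i y" and c: "0 < a i \<bullet> y"
    and u: "int_vec u" "u \<noteq> 0" "\<bar>a i \<bullet> u\<bar> < \<lfloor>a i \<bullet> y\<rfloor> + 1"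
  shows "\<exists>j. 1 \<le> \<bar>a j \<bullet> (u - (a i \<bullet> u / (a i \<bullet> y)) *\<^sub>R y)\<bar>"
proof (rule ccontr)
  define \<theta> where "\<theta> = a i \<bullet> u / (a i \<bullet> y)"
  assume "\<not> ?thesis"
  then have t: "\<bar>a j \<bullet> (u - \<theta> *\<^sub>R y)\<bar> < 1" for j by (auto simp: \<theta>_def not_le)
  have aiu: "a i \<bullet> u = \<theta> * (a i \<bullet> y)" using c by (simp add: \<theta>_def)
  obtain k where k: "a i \<bullet> u = of_int k" using Ints_inner_int_vec[OF ints u(1)] by (auto elim: Ints_cases)
  have "\<bar>a i \<bullet> u\<bar> \<le> a i \<bullet> y"
  proof -
    have "\<bar>k\<bar> < \<lfloor>a i \<bullet> y\<rfloor> + 1" using u(3) unfolding k by linarith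
    then show ?thesis unfolding k by linarith
  qed
  then have \<theta>: "\<bar>\<theta>\<bar> \<le> 1" using c by (simp add: \<theta>_def abs_divide)
  have key: "False" if w: "int_vec w" "a i \<bullet> w = \<tau> * (a i \<bullet> y)" "0 < \<tau>" "\<tau> \<le> 1" "\<And>j. \<bar>a j \<bullet> (w - \<tau> *\<^sub>R y)\<bar> < 1" for w \<tau>
  proof -
    have "- 1 < a j \<bullet> w \<and> a j \<bullet> w < a j \<bullet> y + 1" for j
    proof -
      have "0 \<le> \<tau> * (a j \<bullet> y)" "\<tau> * (a j \<bullet> y) \<le> a j \<bullet> y"
        using w(3,4) y[of j] mult_right_mono[of \<tau> 1 "a j \<bullet> y"] by auto
      then show ?thesis using w(5)[of j] by (auto simp: inner_diff_right)
    qed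
    then have "a i \<bullet> w \<le> 0" using no w(1) by (auto simp: no_step_def)
    moreover have "0 < a i \<bullet> w" using w(2,3) c by simp
    ultimately show False by simp
  qed
  consider "\<theta> = 0" | "0 < \<theta>" | "\<theta> < 0" by linarith
  then show False
  proof cases
    case 1
    then have "a j \<bullet> u = 0" for j using t[of j] Ints_less_1_eq_0 Ints_inner_int_vec[OF ints u(1)] by simp
    then show False using eq_zero_if_orthogonal_to_spanning[OF sp, of u] u(2) by auto
  next
    case 2
    then show False using key[OF u(1) aiu _ _ t] \<theta> by simp
  next
    case 3
    have "\<bar>a j \<bullet> (- u - (- \<theta>) *\<^sub>R y)\<bar> < 1" for j
      using t[of j] by (simp add: inner_diff_right abs_minus_commute)
    moreover have "int_vec (- u)" using u(1) by (simp add: int_vec_def)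
    moreover have "a i \<bullet> - u = - \<theta> * (a i \<bullet> y)" using aiu by simp
    ultimately show False using key[of "- u" "- \<theta>"] 3 \<theta> by simp
  qed
qed

section \<open>Height bounds on faces of dimension 2 and 3\<close>

lemma exists_max_on_finite_type:
  fixes g :: "'a::finite \<Rightarrow> real"
  obtains x where "\<And>y. g y \<le> g x"
proof -
  have "Max (range g) \<in> range g" by (rule Max_in) auto
  then obtain x where "Max (range g) = g x" by (rule imageE)
  then show ?thesis using that[of x] by (metis Max_ge finite finite_imageI rangeI)
qed

lemma inner_eq_sum_of_combination:
  fixes v t :: "real^'n" and r :: "'k::finite \<Rightarrow> real^'n"
  assumes v: "v = (\<Sum>m\<in>UNIV. \<xi> m *s r m)" and "\<And>m. m \<notin> K \<Longrightarrow> r m \<bullet> t = 0"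
  shows "v \<bullet> t = (\<Sum>m\<in>K. \<xi> m * (r m \<bullet> t))"
proof -
  have "v \<bullet> t = (\<Sum>m\<in>UNIV. \<xi> m * (r m \<bullet> t))"
    by (simp add: v inner_sum_left scalar_mult_eq_scaleR)
  also have "\<dots> = (\<Sum>m\<in>K. \<xi> m * (r m \<bullet> t))"
    by (rule sum.mono_neutral_right) (use assms(2) in auto)
  finally show ?thesis .
qed

text \<open>In the basis \<open>r\<close> the error t of the lattice point u is visible only to row
  \<open>i1\<close>: row \<open>i\<close> vanishes on it by construction, and the other rows vanish
  at y and take integer values below 1 in absolute value at u. Hence a_j t is a coefficient times
  r_i1 t.\<close>

lemma height_bound_2face:
  fixes a :: "'m::finite \<Rightarrow> real^'n"
  assumes ints: "\<And>j. int_vec (a j)" and sp: "span (range a) = UNIV"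
    and D: "\<And>f. \<bar>det (\<chi> l. a (f l))\<bar> \<le> D" and Dpos: "0 < D"
    and y: "\<And>j. 0 \<le> a j \<bullet> y" and no: "no_step a i y" and n: "2 \<le> CARD('n)"
    and dimZ: "CARD('n) \<le> dim (a ` {j. a j \<bullet> y = 0}) + 2"
  shows "a i \<bullet> y < D"
proof (rule ccontr)
  define c where "c = a i \<bullet> y"
  assume "\<not> ?thesis"
  then have cD: "D \<le> c" by (simp add: c_def)
  with Dpos have c: "0 < c" by simp
  \<comment> \<open>An integer of absolute value below \<gamma> is at most c, so a body of height
    \<gamma> is as good as one of height c; its volume beats |\<delta>| even if c = D.\<close>
  define \<gamma> where "\<gamma> = of_int \<lfloor>c\<rfloor> + (1::real)"
  have \<gamma>: "c < \<gamma>" unfolding \<gamma>_def by linarith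
  have "a i \<bullet> y \<noteq> 0" using c by (simp add: c_def)
  then obtain f N i0 where f: "card N = 2" "i0 \<in> N" "f i0 = i" "det (\<chi> l. a (f l)) \<noteq> 0"
    "\<And>l. l \<notin> N \<Longrightarrow> a (f l) \<bullet> y = 0"
    using dimZ one_le_numeral n by (rule basis_rows[OF sp]) (rule that)
  obtain i1 where N: "N = {i0, i1}" and i01: "i0 \<noteq> i1"
    using f(1,2) by (metis card_2_iff doubleton_eq_iff insertE singletonD)
  \<comment> \<open>Only row \<open>i1\<close> varies. By Cramer's rule the maximal choice bounds
    the coefficient at \<open>i1\<close> of every row by 1.\<close>
  define g where "g q = \<bar>det (\<chi> l. if l = i1 then a q else a (f l))\<bar>" for q
  obtain q where q: "\<And>q'. g q' \<le> g q" by (rule exists_max_on_finite_type[of g]) (rule that)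
  define r where "r l = (if l = i1 then a q else a (f l))" for l
  define \<delta> where "\<delta> = det (\<chi> l. r l)"
  have gq: "g q = \<bar>\<delta>\<bar>" by (simp add: g_def \<delta>_def r_def)
  have "g (f i1) = \<bar>det (\<chi> l. a (f l))\<bar>"
    unfolding g_def by (intro arg_cong[of _ _ abs] arg_cong[of _ _ det]) (simp add: vec_eq_iff)
  then have "0 < g (f i1)" using f(4) by simp
  then have \<delta>0: "\<delta> \<noteq> 0" using q[of "f i1"] gq by auto
  have \<delta>D: "\<bar>\<delta>\<bar> \<le> D"
  proof -
    have "r = (\<lambda>l. a (if l = i1 then q else f l))" by (auto simp: r_def)
    then show ?thesis using D by (simp add: \<delta>_def)
  qed
  have r0: "r i0 = a i" using f(3) i01 by (simp add: r_def)
  have ry: "r l \<bullet> y = 0" if "l \<notin> {i0, i1}" for l using f(5)[of l] that by (simp add: r_def N)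
  have rint: "int_vec (r l)" for l by (simp add: r_def ints)
  \<comment> \<open>With this multiple of row \<open>i0\<close> subtracted, row \<open>i1\<close>
    vanishes at y. The determinant stays the same, and s_i1 u = r_i1 t.\<close>
  define \<kappa> where "\<kappa> = (r i1 \<bullet> y) / c"
  define \<zeta> where "\<zeta> m = (if m = i1 then 1 else if m = i0 then - \<kappa> else 0)" for m
  define s where "s l = (if l = i1 then \<Sum>m\<in>UNIV. \<zeta> m *s r m else r l)" for l
  have dets: "det (\<chi> l. s l) = \<delta>"
    unfolding s_def det_one_row_combination by (simp add: \<zeta>_def \<delta>_def)
  have s1: "s i1 \<bullet> w = r i1 \<bullet> w - \<kappa> * (r i0 \<bullet> w)" for w
  proof -
    have "s i1 \<bullet> w = (\<Sum>m\<in>UNIV. \<zeta> m * (r m \<bullet> w))"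
      by (simp add: s_def inner_sum_left scalar_mult_eq_scaleR)
    also have "\<dots> = (\<Sum>m\<in>{i0, i1}. \<zeta> m * (r m \<bullet> w))"
      by (rule sum.mono_neutral_right) (auto simp: \<zeta>_def)
    finally show ?thesis using i01 by (simp add: \<zeta>_def)
  qed
  define h where "h = (\<chi> l. if l = i0 then \<gamma> / 2 else 1 / 2 :: real^'n)"
  let ?Q = "box (- h) h"
  have "measure lebesgue ?Q = (\<Prod>l\<in>UNIV. h $ l - (- h) $ l)"
  proof -
    have "(- h) $ l \<le> h $ l" for l using c \<gamma> by (simp add: h_def)
    then show ?thesis
      using content_cbox_cart[of "- h" h] measure_lborel_box_eq[of "- h" h] measure_lborel_cbox_eq[of "- h" h]
      by (simp add: interval_ne_empty_cart)
  qed
  also have "\<dots> = (\<Prod>l\<in>UNIV. if l = i0 then \<gamma> else 1)" by (rule prod.cong) (auto simp: h_def)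
  also have "\<dots> = \<gamma>" by simp
  finally have mQ: "measure lebesgue ?Q = \<gamma>" .
  obtain u z z' where u: "int_vec u" "u \<noteq> 0" "z \<in> ?Q" "z' \<in> ?Q" "\<And>l. s l \<bullet> u = z $ l - z' $ l"
  proof (rule lattice_point_of_large_preimage[of s ?Q])
    show "det (\<chi> l. s l) \<noteq> 0" using \<delta>0 dets by simp
    show "\<bar>det (\<chi> l. s l)\<bar> < measure lebesgue ?Q" unfolding dets mQ using \<delta>D cD \<gamma> by linarith
  qed (auto simp: bounded_box lmeasurable_box)
  have su: "\<bar>s l \<bullet> u\<bar> < 2 * h $ l" for l
    using u(3,4) unfolding u(5) by (auto simp: mem_box_cart abs_less_iff) (smt (verit))+
  have aiu: "\<bar>a i \<bullet> u\<bar> < \<lfloor>a i \<bullet> y\<rfloor> + 1"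
    using su[of i0] i01 by (simp add: s_def r0 h_def \<gamma>_def c_def)
  define t where "t = u - (a i \<bullet> u / (a i \<bullet> y)) *\<^sub>R y"
  have rt: "r l \<bullet> t = 0" if "l \<notin> {i1}" for l
  proof (cases "l = i0")
    case True
    then show ?thesis using c by (simp add: r0 t_def inner_diff_right c_def)
  next
    case False
    then have "\<bar>r l \<bullet> u\<bar> < 1" using su[of l] that by (simp add: s_def h_def)
    then have "r l \<bullet> u = 0" using Ints_less_1_eq_0 Ints_inner_int_vec[OF rint u(1)] by blast
    then show ?thesis using ry[of l] that False by (simp add: t_def inner_diff_right)
  qed
  have "r i1 \<bullet> t = s i1 \<bullet> u" using c by (simp add: s1 r0 t_def inner_diff_right \<kappa>_def c_def)
  then have rt1: "\<bar>r i1 \<bullet> t\<bar> < 1" using su[of i1] i01 by (simp add: h_def)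
  have "\<bar>a j \<bullet> t\<bar> < 1" for j
  proof -
    obtain \<xi> where \<xi>: "a j = (\<Sum>m\<in>UNIV. \<xi> m *s r m)"
      using combination_of_basis_rows[of r "a j"] \<delta>0 by (auto simp: \<delta>_def)
    have "det (\<chi> l. if l = i1 then a j else r l) = \<xi> i1 * \<delta>"
      unfolding \<xi> \<delta>_def by (rule det_one_row_combination)
    moreover have "(\<chi> l. if l = i1 then a j else r l) = (\<chi> l. if l = i1 then a j else a (f l))"
      by (simp add: vec_eq_iff r_def)
    ultimately have "\<bar>\<xi> i1\<bar> * \<bar>\<delta>\<bar> \<le> 1 * \<bar>\<delta>\<bar>"
      using q[of j] unfolding gq by (simp add: g_def abs_mult)
    then have \<xi>1: "\<bar>\<xi> i1\<bar> \<le> 1" using \<delta>0 by simp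
    have "a j \<bullet> t = \<xi> i1 * (r i1 \<bullet> t)"
      using inner_eq_sum_of_combination[OF \<xi>, of "{i1}" t] rt by simp
    then have "\<bar>a j \<bullet> t\<bar> \<le> 1 * \<bar>r i1 \<bullet> t\<bar>" unfolding abs_mult[symmetric] using \<xi>1
      by (simp add: abs_mult mult_left_le_one_le)
    then show ?thesis using rt1 by simp
  qed
  then show False
    using no_near_lattice_point[OF ints sp y no _ u(1,2) aiu] c by (force simp: t_def c_def not_le[symmetric])
qed

text \<open>As in dimension 2, but now t is visible to two rows. Maximising over pairs of
  replacements makes all 2 x 2 determinants of the coefficient pairs at most 1 in absolute value, so
  the polar section has area at least 3/4; the threshold 4/3 is its reciprocal.\<close>

lemma height_bound_3face:
  fixes a :: "'m::finite \<Rightarrow> real^'n"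
  assumes ints: "\<And>j. int_vec (a j)" and sp: "span (range a) = UNIV"
    and D: "\<And>f. \<bar>det (\<chi> l. a (f l))\<bar> \<le> D" and Dpos: "0 < D"
    and y: "\<And>j. 0 \<le> a j \<bullet> y" and no: "no_step a i y" and n: "3 \<le> CARD('n)"
    and dimZ: "CARD('n) \<le> dim (a ` {j. a j \<bullet> y = 0}) + 3"
  shows "a i \<bullet> y < 4 / 3 * D"
proof (rule ccontr)
  define c where "c = a i \<bullet> y"
  assume "\<not> ?thesis"
  then have cD: "4 / 3 * D \<le> c" by (simp add: c_def)
  with Dpos have c: "0 < c" by simp
  define \<gamma> where "\<gamma> = of_int \<lfloor>c\<rfloor> + (1::real)"
  have \<gamma>: "c < \<gamma>" unfolding \<gamma>_def by linarith
  have "a i \<bullet> y \<noteq> 0" using c by (simp add: c_def)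
  then obtain f N i0 where f: "card N = 3" "i0 \<in> N" "f i0 = i" "det (\<chi> l. a (f l)) \<noteq> 0"
    "\<And>l. l \<notin> N \<Longrightarrow> a (f l) \<bullet> y = 0"
    using dimZ one_le_numeral n by (rule basis_rows[OF sp]) (rule that)
  obtain i1 i2 where N: "N = {i0, i1, i2}" and ne: "i0 \<noteq> i1" "i0 \<noteq> i2" "i1 \<noteq> i2"
  proof -
    have "card (N - {i0}) = 2" using f(1,2) by simp
    then obtain i1 i2 where "N - {i0} = {i1, i2}" "i1 \<noteq> i2" by (auto simp: card_2_iff)
    then show ?thesis using that[of i1 i2] f(2) by blast
  qed
  define R where "R q l = (if l = i1 then a (fst q) else if l = i2 then a (snd q) else a (f l))" for q l
  define g where "g q = \<bar>det (\<chi> l. R q l)\<bar>" for q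
  obtain q where q: "\<And>q'. g q' \<le> g q" by (rule exists_max_on_finite_type[of g]) (rule that)
  define r where "r = R q"
  define \<delta> where "\<delta> = det (\<chi> l. r l)"
  have gq: "g q = \<bar>\<delta>\<bar>" by (simp add: g_def \<delta>_def r_def)
  have "R (f i1, f i2) = (\<lambda>l. a (f l))" by (auto simp: R_def)
  then have "0 < g (f i1, f i2)" using f(4) by (simp add: g_def)
  then have \<delta>0: "\<delta> \<noteq> 0" using q[of "(f i1, f i2)"] gq by auto
  have \<delta>D: "\<bar>\<delta>\<bar> \<le> D"
  proof -
    have "r = (\<lambda>l. a (if l = i1 then fst q else if l = i2 then snd q else f l))" by (auto simp: r_def R_def)
    then show ?thesis using D by (simp add: \<delta>_def)
  qed
  have r0: "r i0 = a i" using f(3) ne by (simp add: r_def R_def)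
  have ry: "r l \<bullet> y = 0" if "l \<notin> {i0, i1, i2}" for l using f(5)[of l] that by (simp add: r_def R_def N)
  have rint: "int_vec (r l)" for l by (simp add: r_def R_def ints)
  define \<kappa> where "\<kappa> k = (r k \<bullet> y) / c" for k
  define \<zeta> where "\<zeta> k m = (if m = k then 1 else if m = i0 then - \<kappa> k else 0)" for k m
  define s where "s l = (if l = i1 then \<Sum>m\<in>UNIV. \<zeta> i1 m *s r m
                         else if l = i2 then \<Sum>m\<in>UNIV. \<zeta> i2 m *s r m else r l)" for l
  have dets: "det (\<chi> l. s l) = \<delta>"
    unfolding s_def det_two_rows_combination[OF ne(3)] using ne by (simp add: \<zeta>_def \<delta>_def)
  have sk: "s k \<bullet> w = r k \<bullet> w - \<kappa> k * (r i0 \<bullet> w)" if "k = i1 \<or> k = i2" for k w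
  proof -
    have "s k \<bullet> w = (\<Sum>m\<in>UNIV. \<zeta> k m * (r m \<bullet> w))"
      using that ne by (auto simp: s_def inner_sum_left scalar_mult_eq_scaleR)
    also have "\<dots> = (\<Sum>m\<in>{i0, k}. \<zeta> k m * (r m \<bullet> w))"
      by (rule sum.mono_neutral_right) (auto simp: \<zeta>_def)
    finally show ?thesis using ne that by (auto simp: \<zeta>_def)
  qed
  have "\<forall>j. \<exists>\<xi>. a j = (\<Sum>m\<in>UNIV. \<xi> m *s r m)"
    using combination_of_basis_rows[of r] \<delta>0 by (metis \<delta>_def)
  then obtain \<xi> where \<xi>: "\<And>j. a j = (\<Sum>m\<in>UNIV. \<xi> j m *s r m)" by metis
  define \<pi> where "\<pi> j = (\<xi> j i1, \<xi> j i2)" for j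
  \<comment> \<open>The inserted vectors are the coefficient pairs of r_i1 and r_i2. Their
    determinants with the other pairs are single coefficients, bounded by replacing one row
    only.\<close>
  define P where "P = insert (1, 0) (insert (0, 1) (range \<pi>))"
  have maxdet: "\<bar>x\<bar> \<le> 1" if "x * \<delta> = det (\<chi> l. R p l)" for x p
  proof -
    have "\<bar>x\<bar> * \<bar>\<delta>\<bar> \<le> 1 * \<bar>\<delta>\<bar>" using q[of p] that unfolding gq by (simp add: g_def flip: abs_mult)
    then show ?thesis using \<delta>0 by simp
  qed
  have d2: "\<bar>det2 (\<pi> j) (\<pi> k)\<bar> \<le> 1" for j k
  proof (rule maxdet)
    have "R (j, k) = (\<lambda>l. if l = i1 then \<Sum>m\<in>UNIV. \<xi> j m *s r m else if l = i2 then \<Sum>m\<in>UNIV. \<xi> k m *s r m else r l)"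
      using \<xi> by (auto simp: R_def r_def)
    then show "det2 (\<pi> j) (\<pi> k) * \<delta> = det (\<chi> l. R (j, k) l)"
      using det_two_rows_combination[OF ne(3), of "\<xi> j" r "\<xi> k"] by (simp add: det2_def \<pi>_def \<delta>_def)
  qed
  have c1: "\<bar>\<xi> j i1\<bar> \<le> 1" for j
  proof (rule maxdet)
    have "R (j, snd q) = (\<lambda>l. if l = i1 then \<Sum>m\<in>UNIV. \<xi> j m *s r m else r l)"
      using \<xi> by (auto simp: R_def r_def)
    then show "\<xi> j i1 * \<delta> = det (\<chi> l. R (j, snd q) l)"
      using det_one_row_combination[of i1 "\<xi> j" r] by (simp add: \<delta>_def)
  qed
  have c2: "\<bar>\<xi> j i2\<bar> \<le> 1" for j
  proof (rule maxdet)
    have "R (fst q, j) = (\<lambda>l. if l = i2 then \<Sum>m\<in>UNIV. \<xi> j m *s r m else r l)"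
      using \<xi> ne by (auto simp: R_def r_def)
    then show "\<xi> j i2 * \<delta> = det (\<chi> l. R (fst q, j) l)"
      using det_one_row_combination[of i2 "\<xi> j" r] by (simp add: \<delta>_def)
  qed
  have Pdet: "\<bar>det2 p p'\<bar> \<le> 1" if "p \<in> P" "p' \<in> P" for p p'
    using that d2 c1 c2 by (auto simp: P_def \<pi>_def det2_def)
  define h where "h l = (if l = i0 then \<gamma> / 2 else 1 / 2)" for l
  define E where "E = {s. \<forall>p\<in>P. \<bar>p \<bullet> s\<bar> < 1 / 2}"
  let ?Q = "prism i1 i2 h E"
  have hpos: "0 < h l" for l using c \<gamma> by (simp add: h_def)
  have P: "finite P" "(1, 0) \<in> P" "(0, 1) \<in> P" by (auto simp: P_def)
  note polar = measure_prism_polar[OF P Pdet ne(3), of h, folded E_def, OF _ _ hpos]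
  have "(\<Prod>l\<in>UNIV - {i1, i2}. 2 * h l) = (\<Prod>l\<in>UNIV - {i1, i2}. if l = i0 then \<gamma> else 1)"
    by (rule prod.cong) (auto simp: h_def)
  also have "\<dots> = \<gamma>" using ne by simp
  finally have mQ: "3 / 4 * \<gamma> \<le> measure lebesgue ?Q" using polar(3) by simp
  obtain u z z' where u: "int_vec u" "u \<noteq> 0" "z \<in> ?Q" "z' \<in> ?Q" "\<And>l. s l \<bullet> u = z $ l - z' $ l"
  proof (rule lattice_point_of_large_preimage[of s ?Q])
    show "det (\<chi> l. s l) \<noteq> 0" using \<delta>0 dets by simp
    show "\<bar>det (\<chi> l. s l)\<bar> < measure lebesgue ?Q" unfolding dets using \<delta>D cD \<gamma> mQ by linarith
    show "?Q \<in> lmeasurable" using polar by (intro lmeasurable_open bounded_prism open_prism) auto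
    show "bounded ?Q" using polar by (intro bounded_prism) auto
  qed (rule that)
  have su: "\<bar>s l \<bullet> u\<bar> < 2 * h l" if "l \<noteq> i1" "l \<noteq> i2" for l
  proof -
    have "\<bar>z $ l\<bar> < h l" "\<bar>z' $ l\<bar> < h l" using u(3,4) that by (auto simp: prism_def)
    then show ?thesis unfolding u(5) by linarith
  qed
  have aiu: "\<bar>a i \<bullet> u\<bar> < \<lfloor>a i \<bullet> y\<rfloor> + 1"
    using su[of i0] ne by (simp add: s_def r0 h_def \<gamma>_def c_def)
  define t where "t = u - (a i \<bullet> u / (a i \<bullet> y)) *\<^sub>R y"
  have rt: "r l \<bullet> t = 0" if "l \<notin> {i1, i2}" for l
  proof (cases "l = i0")
    case True
    then show ?thesis using c by (simp add: r0 t_def inner_diff_right c_def)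
  next
    case False
    then have "\<bar>r l \<bullet> u\<bar> < 1" using su[of l] that by (simp add: s_def h_def)
    then have "r l \<bullet> u = 0" using Ints_less_1_eq_0 Ints_inner_int_vec[OF rint u(1)] by blast
    then show ?thesis using ry[of l] that False by (simp add: t_def inner_diff_right)
  qed
  have rk: "r k \<bullet> t = z $ k - z' $ k" if "k = i1 \<or> k = i2" for k
  proof -
    have "r k \<bullet> t = s k \<bullet> u" using c by (simp add: sk[OF that] r0 t_def inner_diff_right \<kappa>_def c_def)
    then show ?thesis using u(5) by simp
  qed
  have "\<bar>a j \<bullet> t\<bar> < 1" for j
  proof -
    have "a j \<bullet> t = \<xi> j i1 * (r i1 \<bullet> t) + \<xi> j i2 * (r i2 \<bullet> t)"
      using inner_eq_sum_of_combination[OF \<xi>, of "{i1, i2}" t j] rt ne by simp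
    also have "\<dots> = \<pi> j \<bullet> (z $ i1, z $ i2) - \<pi> j \<bullet> (z' $ i1, z' $ i2)"
      by (simp add: rk \<pi>_def algebra_simps)
    finally have eq: "a j \<bullet> t = \<dots>" .
    have "\<pi> j \<in> P" by (simp add: P_def)
    then have "\<bar>\<pi> j \<bullet> (z $ i1, z $ i2)\<bar> < 1 / 2" "\<bar>\<pi> j \<bullet> (z' $ i1, z' $ i2)\<bar> < 1 / 2"
      using u(3,4) by (auto simp: prism_def E_def)
    then show ?thesis unfolding eq by linarith
  qed
  then show False
    using no_near_lattice_point[OF ints sp y no _ u(1,2) aiu] c by (force simp: t_def c_def not_le[symmetric])
qed

section \<open>The facet width\<close>

lemma no_step_mono:
  assumes "no_step a i y" "\<And>j. a j \<bullet> w \<le> a j \<bullet> y"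
  shows "no_step a i w"
  using assms unfolding no_step_def by (meson add_right_mono less_le_trans)

text \<open>The bound holds with room for N = 2 (1 against 10/9) and N = 3 (4/3 against 14/9),
  exactly for N = 4 as 2 + 2, and splitting off a 3-dimensional part adds exactly 4/3. From N \<ge>
  5 the remainder N - 3 is at least 2.\<close>

lemma height_bound:
  fixes a :: "'m::finite \<Rightarrow> real^'n"
  assumes ints: "\<And>j. int_vec (a j)" and sp: "span (range a) = UNIV"
    and D: "\<And>f. \<bar>det (\<chi> l. a (f l))\<bar> \<le> D" and Dpos: "0 < D"
    and y: "\<And>j. 0 \<le> a j \<bullet> y" and no: "no_step a i y"
    and N: "2 \<le> N" "N \<le> CARD('n)" and dimZ: "CARD('n) \<le> dim (a ` {j. a j \<bullet> y = 0}) + N"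
  shows "a i \<bullet> y < (4 * real N + 2) / 9 * D"
  using y no N dimZ
proof (induction N arbitrary: y rule: less_induct)
  case (less N)
  \<comment> \<open>Both parts of the split are dominated by \<open>y\<close> in every row, so each
    inherits \<open>no_step\<close>.\<close>
  have split: "a i \<bullet> y < \<alpha> + \<beta>"
    if de: "N = d + e"
      and \<alpha>: "\<And>w. \<lbrakk>\<And>j. 0 \<le> a j \<bullet> w; no_step a i w; CARD('n) \<le> dim (a ` {j. a j \<bullet> w = 0}) + d\<rbrakk> \<Longrightarrow> a i \<bullet> w < \<alpha>"
      and \<beta>: "\<And>w. \<lbrakk>\<And>j. 0 \<le> a j \<bullet> w; no_step a i w; CARD('n) \<le> dim (a ` {j. a j \<bullet> w = 0}) + e\<rbrakk> \<Longrightarrow> a i \<bullet> w < \<beta>"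
    for d e \<alpha> \<beta>
  proof -
    have "DIM(real^'n) \<le> dim (a ` {j. a j \<bullet> y = 0}) + d + e" using less.prems(5) de by simp
    then obtain w where w: "\<And>j. 0 \<le> a j \<bullet> w" "\<And>j. a j \<bullet> w \<le> a j \<bullet> y"
      "CARD('n) \<le> dim (a ` {j. a j \<bullet> w = 0}) + d" "CARD('n) \<le> dim (a ` {j. a j \<bullet> (y - w) = 0}) + e"
      using spindle_split[OF sp less.prems(1)] by (metis DIM_cart DIM_real mult.right_neutral)
    have "a i \<bullet> w < \<alpha>" using w no_step_mono[OF less.prems(2), of w] by (intro \<alpha>) auto
    moreover have "a i \<bullet> (y - w) < \<beta>"
      using w no_step_mono[OF less.prems(2), of "y - w"] by (intro \<beta>) (auto simp: inner_diff_right)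
    ultimately show ?thesis by (simp add: inner_diff_right)
  qed
  note two = height_bound_2face[OF ints sp D Dpos] and three = height_bound_3face[OF ints sp D Dpos]
  consider "N = 2" | "N = 3" | "N = 4" | "5 \<le> N" using less.prems(3) by linarith
  then show ?case
  proof cases
    case 1
    then have "a i \<bullet> y < D" using less.prems by (intro two) auto
    then show ?thesis using 1 Dpos by simp
  next
    case 2
    then have "a i \<bullet> y < 4 / 3 * D" using less.prems by (intro three) auto
    then show ?thesis using 2 Dpos by simp
  next
    case 3
    have "a i \<bullet> y < D + D"
      by (rule split[of 2 2]) (use 3 less.prems(4) in \<open>auto intro!: two\<close>)
    then show ?thesis using 3 by simp
  next
    case 4
    have "a i \<bullet> y < 4 / 3 * D + (4 * real (N - 3) + 2) / 9 * D"
    proof (rule split[of 3 "N - 3"])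
      show "a i \<bullet> w < 4 / 3 * D"
        if "\<And>j. 0 \<le> a j \<bullet> w" "no_step a i w" "CARD('n) \<le> dim (a ` {j. a j \<bullet> w = 0}) + 3" for w
        using that 4 less.prems(4) by (intro three) auto
      show "a i \<bullet> w < (4 * real (N - 3) + 2) / 9 * D"
        if "\<And>j. 0 \<le> a j \<bullet> w" "no_step a i w" "CARD('n) \<le> dim (a ` {j. a j \<bullet> w = 0}) + (N - 3)" for w
        using that 4 less.prems(4) by (intro less.IH) auto
    qed (use 4 in simp)
    also have "\<dots> = (4 * real N + 2) / 9 * D" using 4 by (simp add: of_nat_diff field_simps)
    finally show ?thesis .
  qed
qed

section \<open>Maximal minors and the final estimate\<close>

lemma span_rows_full_rank:
  fixes A :: "real^'n^'m"
  assumes "rank A = CARD('n)"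
  shows "span (range (\<lambda>j. A $ j)) = UNIV"
proof -
  have "rows A = range (\<lambda>j. A $ j)" by (auto simp: rows_def row_def vec_lambda_eta)
  then have "dim (range (\<lambda>j. A $ j)) = DIM(real^'n)" using assms by (simp add: row_rank_def)
  then show ?thesis by (simp only: dim_eq_full)
qed

lemma det_row_selection_le_Delta:
  fixes A :: "real^'n^'m" and f :: "'n \<Rightarrow> 'm"
  assumes "inj f"
  shows "\<bar>det (\<chi> l. A $ f l)\<bar> \<le> Delta A"
proof -
  have "{\<bar>det ((\<chi> i. A $ f i) :: real^'n^'n)\<bar> | f :: 'n \<Rightarrow> 'm. inj f}
      \<subseteq> range (\<lambda>f :: 'n \<Rightarrow> 'm. \<bar>det ((\<chi> i. A $ f i) :: real^'n^'n)\<bar>)" by auto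
  then have "finite {\<bar>det ((\<chi> i. A $ f i) :: real^'n^'n)\<bar> | f :: 'n \<Rightarrow> 'm. inj f}"
    by (rule finite_subset) simp
  then show ?thesis unfolding Delta_def by (rule Max_ge) (use assms in blast)
qed

lemma det_row_selection_not_inj:
  fixes A :: "real^'n^'m" and f :: "'n \<Rightarrow> 'm"
  assumes "\<not> inj f"
  shows "det (\<chi> l. A $ f l) = 0"
proof -
  obtain k l where "k \<noteq> l" "f k = f l" using assms by (auto simp: inj_def)
  then show ?thesis by (intro det_identical_rows[of k l]) (simp_all add: row_def)
qed

text \<open>With k = n, \<open>basis_rows\<close> asks for no row to vanish at y and simply extracts
  a nonsingular selection of n rows.\<close>

lemma Delta_pos:
  fixes A :: "real^'n^'m"
  assumes "span (range (\<lambda>j. A $ j)) = UNIV"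
  shows "0 < Delta A"
proof -
  have "\<exists>i. A $ i \<noteq> 0"
  proof (rule ccontr)
    assume "\<not> ?thesis"
    then have "axis undefined (1::real) = (0 :: real^'n)"
      by (intro eq_zero_if_orthogonal_to_spanning[OF assms]) auto
    then show False by (simp add: axis_eq_0_iff)
  qed
  then obtain i where "A $ i \<bullet> A $ i \<noteq> 0" by auto
  then obtain f :: "'n \<Rightarrow> 'm" where f: "det (\<chi> l. A $ f l) \<noteq> 0"
    using basis_rows[OF assms, of i "A $ i" "CARD('n)"] by (metis One_nat_def Suc_leI le_add2 order_refl zero_less_card_finite)
  then have "inj f" using det_row_selection_not_inj by blast
  from det_row_selection_le_Delta[OF this, of A] f show ?thesis by linarith
qed

theorem theorem4:
  fixes A :: "real^'n^'m" and b :: "real^'m"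
  assumes n2: "CARD('n) \<ge> 2"
    and A_int: "\<forall>i j. A $ i $ j \<in> \<int>"
    and b_int: "\<forall>i. b $ i \<in> \<int>"
    and full_rank: "rank A = CARD('n)"
    and full_dim: "aff_dim (polyh A b) = int CARD('n)"
    and no_int: "\<forall>x\<in>polyh A b. \<not> (\<forall>j. x $ j \<in> \<int>)"
    and facets: "\<forall>i. {x \<in> polyh A b. A $ i \<bullet> x = b $ i} facet_of polyh A b"
  shows "\<exists>i. width (A $ i) (polyh A b) < ereal ((4 * real CARD('n) + 2) / 9 * Delta A - 1)"
proof -
  define \<beta> where "\<beta> = (4 * real CARD('n) + 2) / 9 * Delta A"
  have spA: "span (range (\<lambda>j. A $ j)) = UNIV" using full_rank by (rule span_rows_full_rank)
  have \<Delta>: "0 < Delta A" using spA by (rule Delta_pos)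
  have mem_P: "x \<in> polyh A b \<longleftrightarrow> (\<forall>j. A $ j \<bullet> x \<le> b $ j)" for x
    by (simp add: polyh_def matrix_vector_mul_component)
  have intA: "int_vec (A $ j)" for j using A_int by (simp add: int_vec_def)
  have int_step: "x \<le> b $ j" if x: "x \<in> \<int>" "x < b $ j + 1" for x j
  proof -
    obtain k m where "x = of_int k" "b $ j = of_int m" using x(1) b_int by (metis Ints_cases)
    moreover from this x(2) have "k < m + 1" by linarith
    ultimately show ?thesis by simp
  qed
  define feas where "feas I z \<longleftrightarrow> int_vec z \<and> (\<forall>j\<in>I. A $ j \<bullet> z \<le> b $ j)" for I z
  have "\<nexists>z. feas UNIV z" using no_int by (auto simp: feas_def mem_P int_vec_def)
  then obtain I where I: "\<nexists>z. feas I z" and Imin: "\<And>J. \<nexists>z. feas J z \<Longrightarrow> card I \<le> card J"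
    using ex_has_least_nat[of "\<lambda>J. \<nexists>z. feas J z" UNIV card] by blast
  have "I \<noteq> {}"
  proof
    assume "I = {}"
    then have "feas I 0" by (simp add: feas_def int_vec_def)
    then show False using I by blast
  qed
  then obtain i where i: "i \<in> I" by blast
  then have "card (I - {i}) < card I" by (intro card_Diff1_less) auto
  then have "\<exists>z. feas (I - {i}) z" using Imin[of "I - {i}"] by (meson not_le)
  \<comment> \<open>The natural-number rounding serves well-foundedness only. The values a_i w - b_i
    are integers and at least 1 by \<open>above\<close>, so \<open>zmin'\<close> recovers the
    comparison without loss.\<close>
  then obtain z where z: "feas (I - {i}) z"
    and zmin: "\<And>w. feas (I - {i}) w \<Longrightarrow> nat \<lfloor>A $ i \<bullet> z - b $ i\<rfloor> \<le> nat \<lfloor>A $ i \<bullet> w - b $ i\<rfloor>"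
    using ex_has_least_nat[of "feas (I - {i})" _ "\<lambda>z. nat \<lfloor>A $ i \<bullet> z - b $ i\<rfloor>"] by blast
  have above: "b $ i + 1 \<le> A $ i \<bullet> w" if w: "feas (I - {i}) w" for w
  proof (rule ccontr)
    assume "\<not> ?thesis"
    moreover have "A $ i \<bullet> w \<in> \<int>" using w Ints_inner_int_vec[OF intA] by (simp add: feas_def)
    ultimately have "A $ i \<bullet> w \<le> b $ i" by (intro int_step) auto
    then have "feas I w" using w by (auto simp: feas_def)
    then show False using I by blast
  qed
  have zmin': "A $ i \<bullet> z \<le> A $ i \<bullet> w" if w: "feas (I - {i}) w" for w
  proof -
    have "A $ i \<bullet> z - b $ i \<in> \<int>" "A $ i \<bullet> w - b $ i \<in> \<int>"
      using z w Ints_inner_int_vec[OF intA] b_int by (auto simp: feas_def)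
    then obtain k m where "A $ i \<bullet> z - b $ i = of_int k" "A $ i \<bullet> w - b $ i = of_int m" by (auto elim!: Ints_cases)
    with zmin[OF w] above[OF w] above[OF z] show ?thesis by simp
  qed
  have gap: "A $ i \<bullet> z - A $ i \<bullet> x < \<beta>" if x: "x \<in> polyh A b" for x
  proof -
    \<comment> \<open>Changing the signs of rows keeps every |det|. Row \<open>i\<close> is
      reversed, since a_i x \<le> b_i < a_i z; a forbidden step therefore lowers a_i below its value
      at z.\<close>
    define \<sigma> where "\<sigma> j = (if 0 \<le> A $ j \<bullet> (x - z) then 1 else - 1 :: real)" for j
    define a where "a j = \<sigma> j *s A $ j" for j
    have aj: "a j \<bullet> w = \<sigma> j * (A $ j \<bullet> w)" for j w by (simp add: a_def scalar_mult_eq_scaleR)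
    have "A $ i \<bullet> (x - z) < 0" using x above[OF z] by (simp add: mem_P inner_diff_right) (smt (verit))
    then have \<sigma>i: "\<sigma> i = - 1" by (simp add: \<sigma>_def)
    have "a i \<bullet> (x - z) < (4 * real CARD('n) + 2) / 9 * Delta A"
    proof (rule height_bound[where a = a and D = "Delta A"])
      show "int_vec (a j)" for j using intA[of j] by (auto simp: a_def int_vec_def \<sigma>_def)
      show "span (range a) = UNIV"
      proof (rule span_eq_UNIV_mono[OF _ spA])
        have "A $ j = \<sigma> j *\<^sub>R a j" for j by (simp add: a_def \<sigma>_def scalar_mult_eq_scaleR)
        then show "range (\<lambda>j. A $ j) \<subseteq> span (range a)"
          by (metis image_subset_iff rangeI span_base span_scale)
      qed
      show "\<bar>det (\<chi> l. a (f l))\<bar> \<le> Delta A" for f :: "'n \<Rightarrow> 'm"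
      proof -
        have "\<bar>\<Prod>l\<in>UNIV. \<sigma> (f l)\<bar> = 1" unfolding abs_prod by (rule prod.neutral) (simp add: \<sigma>_def)
        then have "\<bar>det (\<chi> l. a (f l))\<bar> = \<bar>det (\<chi> l. A $ f l)\<bar>"
          unfolding a_def det_rows_mul by (simp add: abs_mult)
        also have "\<dots> \<le> Delta A"
          using det_row_selection_le_Delta[of f A] det_row_selection_not_inj[of f A] \<Delta> by (cases "inj f") auto
        finally show ?thesis .
      qed
      show "0 \<le> a j \<bullet> (x - z)" for j by (simp add: aj \<sigma>_def)
      show "no_step a i (x - z)"
        unfolding no_step_def
      proof (intro allI impI, rule ccontr)
        fix u assume u: "int_vec u" and step: "\<forall>j. - 1 < a j \<bullet> u \<and> a j \<bullet> u < a j \<bullet> (x - z) + 1"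
          and "\<not> a i \<bullet> u \<le> 0"
        then have down: "A $ i \<bullet> u < 0" by (simp add: aj \<sigma>i)
        have "feas (I - {i}) (z + u)"
          unfolding feas_def
        proof (intro conjI ballI)
          show zu: "int_vec (z + u)" using u z by (simp add: feas_def int_vec_def)
          fix j assume j: "j \<in> I - {i}"
          show "A $ j \<bullet> (z + u) \<le> b $ j"
          \<comment> \<open>A row that kept its sign is controlled by x through the upper bound of
            the step; a reversed row is controlled by z through the lower bound -1. Integrality
            removes the excess of less than 1 in both cases.\<close>
          proof (cases "0 \<le> A $ j \<bullet> (x - z)")
            case True
            then have "A $ j \<bullet> (z + u) < A $ j \<bullet> x + 1"
              using step[rule_format, of j] by (simp add: aj \<sigma>_def inner_add_right inner_diff_right)
            also have "\<dots> \<le> b $ j + 1" using x by (simp add: mem_P)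
            finally show ?thesis by (intro int_step Ints_inner_int_vec intA zu)
          next
            case False
            then have "A $ j \<bullet> u < 1" using step[rule_format, of j] by (simp add: aj \<sigma>_def)
            then have "A $ j \<bullet> (z + u) < b $ j + 1" using z j by (force simp: feas_def inner_add_right)
            then show ?thesis by (intro int_step Ints_inner_int_vec intA zu)
          qed
        qed
        from zmin'[OF this] down show False by (simp add: inner_add_right)
      qed
    qed (use n2 \<Delta> in auto)
    then show ?thesis by (simp add: aj \<sigma>i \<beta>_def inner_diff_right)
  qed
  \<comment> \<open>The strict bound \<open>gap\<close> holds pointwise; a vertex \<open>v\<close>
    minimising a_i over P carries it over to the infimum.\<close>
  define H where "H = range (\<lambda>j. (A $ j, b $ j))"
  have H: "halfspaces_Int H = polyh A b" by (auto simp: H_def halfspaces_Int_def mem_P)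
  have "polyh A b \<noteq> {}" using full_dim by auto
  moreover have "span (fst ` H) = UNIV" using spA by (simp add: H_def image_image)
  moreover have "A $ i \<bullet> z - \<beta> \<le> A $ i \<bullet> y" if "y \<in> polyh A b" for y using gap[OF that] by simp
  ultimately obtain v where v: "is_vertex H v" "\<And>y. y \<in> polyh A b \<Longrightarrow> A $ i \<bullet> v \<le> A $ i \<bullet> y"
    using linear_min_at_vertex[of H "A $ i \<bullet> z - \<beta>" "A $ i"] unfolding H by (auto simp: H_def)
  have vP: "v \<in> polyh A b" using v(1) by (simp add: is_vertex_def H)
  have "width (A $ i) (polyh A b) \<le> ereal (b $ i) - ereal (A $ i \<bullet> v)"
    unfolding width_def
  proof (rule ereal_minus_mono)
    show "(SUP x\<in>polyh A b. ereal (A $ i \<bullet> x)) \<le> ereal (b $ i)" by (rule SUP_least) (simp add: mem_P)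
    show "ereal (A $ i \<bullet> v) \<le> (INF y\<in>polyh A b. ereal (A $ i \<bullet> y))" by (rule INF_greatest) (simp add: v(2))
  qed
  also have "\<dots> < ereal (\<beta> - 1)" using gap[OF vP] above[OF z] by simp
  finally show ?thesis unfolding \<beta>_def by blast
qed

end
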